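(* Let $q>1$ be an integer, let $\chi:\mathbb{Z}\to\mathbb{C}$ be a non-principal Dirichlet character of modulus $q$ with Dirichlet $L$-function $L(\cdot,\chi)$, and let $s\in\mathbb{C}$ with $\mathrm{Re}\,s\in(0,1)$. Let $\varphi_{s,q}$ and $\gamma_{s,q}$ be the functions on $\mathbb{R}$ defined in the context. Then: (a) If $L(s,\chi)=0$, then $\varphi_{s,q}-\gamma_{s,q}\in L_p(\mathbb{R})$ for every $p\in(1/2,\infty)$. (b) If there exists $p\in(1/2,\infty)$ such that $\varphi_{s,q}-\gamma_{s,q}\in L_p(\mathbb{R})$, then $L(s,\chi)=0$.
   Context: $\mathbb{N}=\{1,2,\ldots\}$. For a non-principal $\chi$, $L(s,\chi)=\sum_{l=1}^\infty\chi(l)l^{-s}$ converges for $\mathrm{Re}\,s>0$. Let $E(\chi):=\{n\in\mathbb{Z}:\sum_{l=1}^{q-1}\chi(l)e^{2\pi inl/q}=0\}$. For $\mathrm{Re}\,s\in(0,1)$ and $y\in\mathbb{R}$, $$\varphi_{s,q}(y):=-\pi2^{s-2}\left(\frac{|y|^s\sum_{l=1}^{q-1}\chi(l)\sin[(2l/q-1)y]}{\sin(\pi s/2)}+\frac{|y|^s\,\mathrm{sgn}(y)\sum_{l=1}^{q-1}\chi(l)\cos[(2l/q-1)y]}{\cos(\pi s/2)}\right),$$ $$\gamma_{s,q}(y):=-\frac{\pi2^sy^{2}\sin y}{\sin(\pi s)}\sum_{n\in\mathbb{N}\setminus E(\chi)}\frac{(\pi n)^{s-1}\sum_{l=1}^{q-1}\chi(l)\sin[2\pi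 nl/q+\pi s/2]}{y^2-(\pi n)^2}.$$ At $y=\pm\pi n$ the product $\sin y/(y^2-(\pi n)^2)$ is understood by continuity. Complex powers of positive reals are principal, and $0^s=0$. For $0<p<\infty$, $L_p(\mathbb{R})$ is the space of measurable $F:\mathbb{R}\to\mathbb{C}$ with $\int_{\mathbb{R}}|F(y)|^p\,dy<\infty$ (also for $p<1$). *)

theory Defs
  imports "HOL-Analysis.Analysis"
begin

definition dirichlet_character :: "nat \<Rightarrow> (int \<Rightarrow> complex) \<Rightarrow> bool" where
  "dirichlet_character q chi \<longleftrightarrow>
     (\<forall>m n. chi (m * n) = chi m * chi n) \<and>
     (\<forall>m. chi (m + int q) = chi m) \<and>
     (\<forall>m. chi m \<noteq> 0 \<longleftrightarrow> coprime m (int q))"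

definition principal_character :: "nat \<Rightarrow> int \<Rightarrow> complex" where
  "principal_character q n = (if coprime n (int q) then 1 else 0)"

(* The Dirichlet series as an ordinary (conditionally convergent) series over l = Suc k.
   It represents the L-function of a non-principal character only for Re s > 0. *)
definition Dirichlet_L :: "(int \<Rightarrow> complex) \<Rightarrow> complex \<Rightarrow> complex" where
  "Dirichlet_L chi s = (\<Sum>k. chi (int (Suc k)) * of_nat (Suc k) powr (- s))"

definition exceptional_set :: "nat \<Rightarrow> (int \<Rightarrow> complex) \<Rightarrow> int set" where
  "exceptional_set q chi =
     {n. (\<Sum>l=1..q-1. chi (int l) * exp (2 * of_real pi * \<i> * of_int n * of_nat l / of_nat q)) = 0}"

definition varphi :: "nat \<Rightarrow> (int \<Rightarrow> complex) \<Rightarrow> complex \<Rightarrow> real \<Rightarrow> complex" where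
  "varphi q chi s y =
     - of_real pi * 2 powr (s - 2) *
       (of_real \<bar>y\<bar> powr s *
          (\<Sum>l=1..q-1. chi (int l) * of_real (sin ((2 * real l / real q - 1) * y)))
          / sin (of_real pi * s / 2)
        + of_real \<bar>y\<bar> powr s * of_real (sgn y) *
          (\<Sum>l=1..q-1. chi (int l) * of_real (cos ((2 * real l / real q - 1) * y)))
          / cos (of_real pi * s / 2))"

(* sin y / (y^2 - (pi n)^2), extended by continuity to y = pi n and y = - pi n (n > 0) *)
definition sin_quotient :: "nat \<Rightarrow> real \<Rightarrow> real" where
  "sin_quotient n y =
     (if y\<^sup>2 = (pi * real n)\<^sup>2 then cos y / (2 * y) else sin y / (y\<^sup>2 - (pi * real n)\<^sup>2))"

lemma isCont_sin_quotient:
  assumes "n > 0"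
  shows "isCont (sin_quotient n) y"
proof (cases "y\<^sup>2 = (pi * real n)\<^sup>2")
  case True
  have "y \<noteq> 0"
    using True assms by auto
  have "y = pi * real n \<or> y = - (pi * real n)"
    using True by (simp add: power2_eq_iff)
  hence sin0: "sin y = 0"
    by (auto simp: mult.commute[of pi])
  have "((\<lambda>t. (sin t - sin y) / (t - y) / (t + y)) \<longlongrightarrow> cos y / (y + y)) (at y)"
    using DERIV_sin[of y] \<open>y \<noteq> 0\<close>
    by (intro tendsto_divide tendsto_add tendsto_ident_at tendsto_const)
       (auto simp: has_field_derivative_iff)
  moreover have "\<forall>\<^sub>F t in at y. (sin t - sin y) / (t - y) / (t + y) = sin_quotient n t"
  proof -
    have "\<forall>\<^sub>F t in at y. t \<noteq> y \<and> t \<noteq> - y"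
      using \<open>y \<noteq> 0\<close> by (auto intro!: eventually_conj eventually_neq_at_within)
    thus ?thesis
    proof eventually_elim
      case (elim t)
      hence "t\<^sup>2 \<noteq> y\<^sup>2" by (simp add: power2_eq_iff)
      moreover have "(t - y) * (t + y) = t\<^sup>2 - y\<^sup>2"
        by (simp add: power2_eq_square algebra_simps)
      ultimately show ?case
        using True sin0 by (simp add: sin_quotient_def)
    qed
  qed
  ultimately have "(sin_quotient n \<longlongrightarrow> cos y / (y + y)) (at y)"
    by (rule Lim_transform_eventually)
  thus ?thesis
    using True by (simp add: isCont_def sin_quotient_def)
next
  case False
  have "\<forall>\<^sub>F t in nhds y. t\<^sup>2 - (pi * real n)\<^sup>2 \<noteq> 0"
  proof (rule tendsto_imp_eventually_ne)
    have "isCont (\<lambda>t. t\<^sup>2 - (pi * real n)\<^sup>2) y"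
      by (intro continuous_intros)
    thus "((\<lambda>t. t\<^sup>2 - (pi * real n)\<^sup>2) \<longlongrightarrow> y\<^sup>2 - (pi * real n)\<^sup>2) (nhds y)"
      using tendsto_at_iff_tendsto_nhds[of "\<lambda>t. t\<^sup>2 - (pi * real n)\<^sup>2" y]
      by (simp add: isCont_def)
  qed (use False in simp)
  hence "\<forall>\<^sub>F t in nhds y. sin_quotient n t = sin t / (t\<^sup>2 - (pi * real n)\<^sup>2)"
    by eventually_elim (simp add: sin_quotient_def)
  moreover have "isCont (\<lambda>t. sin t / (t\<^sup>2 - (pi * real n)\<^sup>2)) y"
    using False by (intro continuous_intros) auto
  ultimately show ?thesis
    by (simp add: isCont_cong)
qed

(* The factor sin y is moved inside the sum so that each summand is defined by continuity. *)
definition gamma_fun :: "nat \<Rightarrow> (int \<Rightarrow> complex) \<Rightarrow> complex \<Rightarrow> real \<Rightarrow> complex" where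
  "gamma_fun q chi s y =
     - (of_real pi * 2 powr s * of_real (y\<^sup>2) / sin (of_real pi * s)) *
       (\<Sum>\<^sub>\<infinity>n\<in>{n::nat. n \<ge> 1 \<and> int n \<notin> exceptional_set q chi}.
          of_real (pi * real n) powr (s - 1) *
          (\<Sum>l=1..q-1. chi (int l) *
             sin (of_real (2 * pi * real n * real l / real q) + of_real pi * s / 2)) *
          of_real (sin_quotient n y))"

definition L_space :: "real \<Rightarrow> (real \<Rightarrow> complex) set" where
  "L_space p =
     {F \<in> borel_measurable lebesgue. (\<integral>\<^sup>+ y. ennreal (norm (F y) powr p) \<partial>lebesgue) < \<infinity>}"

end

theory Submission
  imports Defs
begin

text \<open>
  Let \<open>\<theta>(t) = \<Sum>\<^sub>n \<chi>(n) e\<^bsup>-2nt/q\<^esup>\<close>. For \<open>y > 0\<close> with \<open>sin y \<noteq> 0\<close> one has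
  \<open>\<phi>(y) - \<gamma>(y) = 2\<^sup>s y\<^sup>2 sin y \<integral> t\<^bsup>s-1\<^esup> \<theta>(t) / (t\<^sup>2 + y\<^sup>2) dt\<close>, the integral being over \<open>(0, \<infinity>)\<close>.
  To see this, expand \<open>\<theta>\<close> into partial fractions with poles at the points \<open>i\<pi>n\<close>, integrate term by term, and
  resum the part depending on \<open>y\<close> by the same partial fraction expansion at the points \<open>y\<close> and \<open>-y\<close>.
  Because \<open>\<theta>\<close> decays exponentially, \<open>y\<^sup>2\<close> times the integral is \<open>J + O(y\<^bsup>-2\<^esup>)\<close>, where
  \<open>J = \<integral> t\<^bsup>s-1\<^esup> \<theta>(t) dt = \<Gamma>(s) (q/2)\<^sup>s L(s, \<chi>)\<close>. So the odd function \<open>\<phi> - \<gamma>\<close> is \<open>O(1 / (1 + y\<^sup>2))\<close> when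
  \<open>L(s, \<chi>) = 0\<close>, and otherwise it is bounded below by a multiple of \<open>|sin y|\<close> for large \<open>y\<close>, which is in
  no \<open>L\<^sub>p\<close>.
\<close>

section \<open>Finite Fourier transform of the character\<close>

text \<open>The link between theta and the trigonometric sums is \<open>char_csc\<close>, which has
  simple poles at the points pi n with the Gauss sums as residues. On the imaginary axis it is theta
  up to a constant factor; on the real axis its odd and even parts are, up to a constant and
  division by sin y, the cosine and sine sums of \<open>varphi\<close>. So one expansion serves both
  for the termwise integration and for the resummation. The obstacle is conditional convergence: the
  Gauss sums are merely bounded. The pole series is therefore summed over whole periods, where the
  Gauss sums add up to zero, and then made absolutely convergent by subtracting values at 0. This
  leaves an unknown constant, which enters once through theta and once through the points y and -y,
  with opposite signs. The even and odd parts of the Gauss sums are carried side by side, which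
  avoids a case distinction on chi(-1). The bound 1/2 for p is the point at which y^(-2) becomes
  p-integrable at infinity.\<close>

lemma exp_2pi_of_int: "exp (2 * of_int n * of_real pi * \<i>) = (1 :: complex)"
  unfolding exp_eq_1 by (auto intro!: exI[of _ n])

lemma sum_roots_of_unity:
  fixes d :: int
  assumes "q > 0"
  shows "(\<Sum>k<q. exp (2 * of_real pi * \<i> * of_nat k * of_int d / of_nat q)) =
    (if int q dvd d then of_nat q else 0 :: complex)"
proof -
  define r where "r = exp (2 * of_real pi * \<i> * of_int d / of_nat q :: complex)"
  have pw: "exp (2 * of_real pi * \<i> * of_nat k * of_int d / of_nat q) = r ^ k" for k
    unfolding r_def by (simp add: exp_of_nat_mult [symmetric] algebra_simps)
  have rq: "r ^ q = 1"
  proof -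
    have "r ^ q = exp (of_nat q * (2 * of_real pi * \<i> * of_int d / of_nat q))"
      unfolding r_def by (rule exp_of_nat_mult [symmetric])
    also have "\<dots> = exp (2 * of_int d * of_real pi * \<i>)"
      using assms by (simp add: field_simps)
    also have "\<dots> = 1" by (rule exp_2pi_of_int)
    finally show ?thesis .
  qed
  have r1: "r = 1 \<longleftrightarrow> int q dvd d"
  proof -
    have "r = 1 \<longleftrightarrow> (\<exists>n::int. 2 * pi * of_int d / of_nat q = of_int (2 * n) * pi)"
      unfolding r_def exp_eq_1 by simp
    also have "\<dots> \<longleftrightarrow> (\<exists>n::int. (of_int d :: real) = of_int (n * int q))"
      using assms by (simp add: field_simps)
    also have "\<dots> \<longleftrightarrow> int q dvd d"
      unfolding of_int_eq_iff by (auto simp: dvd_def mult.commute)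
    finally show ?thesis .
  qed
  show ?thesis
  proof (cases "int q dvd d")
    case True
    then show ?thesis using r1 by (simp add: pw)
  next
    case False
    then have "r \<noteq> 1" using r1 by simp
    then show ?thesis using False geometric_sum[of r q] rq by (simp add: pw)
  qed
qed

section \<open>The character and its Gauss sums\<close>

locale nonprincipal_character =
  fixes q :: nat and chi :: "int \<Rightarrow> complex"
  assumes q_gt_1: "q > 1"
    and character: "dirichlet_character q chi"
    and nonprincipal: "chi \<noteq> principal_character q"
begin

lemma chi_mult: "chi (m * n) = chi m * chi n"
  using character by (simp add: dirichlet_character_def)

lemma chi_period: "chi (m + int q) = chi m"
  using character by (simp add: dirichlet_character_def)

lemma chi_eq_0_iff: "chi m = 0 \<longleftrightarrow> \<not> coprime m (int q)"
  using character by (auto simp: dirichlet_character_def)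

lemma chi_add_nat_mult: "chi (m + int k * int q) = chi m"
proof (induction k)
  case (Suc k)
  have "chi (m + int (Suc k) * int q) = chi ((m + int k * int q) + int q)"
    by (simp add: algebra_simps)
  then show ?case using chi_period Suc.IH by simp
qed simp

lemma chi_add_mult: "chi (m + k * int q) = chi m"
proof (cases "k \<ge> 0")
  case True
  then show ?thesis using chi_add_nat_mult[of m "nat k"] by simp
next
  case False
  then show ?thesis using chi_add_nat_mult[of "m + k * int q" "nat (-k)"] by simp
qed

lemma chi_mod: "chi (m mod int q) = chi m"
  using chi_add_mult[of "m mod int q" "m div int q"] by (simp add: mult.commute)

lemma chi_0: "chi 0 = 0"
  using q_gt_1 by (simp add: chi_eq_0_iff)

lemma sum_lessThan_eq: "f 0 = 0 \<Longrightarrow> (\<Sum>l<q. f l) = (\<Sum>l=1..q-1. f l)" for f :: "nat \<Rightarrow> complex"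
proof -
  assume "f 0 = 0"
  moreover have "{..<q} = insert 0 {1..q-1}" using q_gt_1 by auto
  ultimately show ?thesis by simp
qed

text \<open>Multiplication by a unit \<open>a\<close> permutes the residues mod \<open>q\<close>, so
  the sum equals \<open>chi a\<close> times itself, and non-principality supplies a unit with
  \<open>chi a\<close> different from 1. This is the point where non-principality enters.\<close>

lemma sum_chi: "(\<Sum>l=1..q-1. chi (int l)) = 0"
proof -
  obtain a where a: "chi a \<noteq> principal_character q a" using nonprincipal by auto
  have cop: "coprime a (int q)"
    using a chi_eq_0_iff[of a] by (auto simp: principal_character_def split: if_splits)
  have a1: "chi a \<noteq> 1" using a cop by (simp add: principal_character_def)
  define f where "f l = nat ((a * int l) mod int q)" for l
  have inj: "inj_on f {..<q}"
  proof (rule inj_onI)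
    fix x y assume xy: "x \<in> {..<q}" "y \<in> {..<q}" "f x = f y"
    then have "(a * int x) mod int q = (a * int y) mod int q"
      using q_gt_1 by (simp add: f_def nat_eq_iff)
    then have "int q dvd a * (int x - int y)"
      by (simp add: mod_eq_dvd_iff right_diff_distrib)
    then have "int q dvd int x - int y"
      using cop by (simp add: coprime_commute coprime_dvd_mult_right_iff)
    then have "int x mod int q = int y mod int q" by (simp add: mod_eq_dvd_iff)
    then show "x = y" using xy by simp
  qed
  have "f ` {..<q} \<subseteq> {..<q}"
    using q_gt_1 by (auto simp: f_def nat_less_iff)
  then have "f ` {..<q} = {..<q}"
    using inj by (simp add: card_image card_subset_eq)
  then have bij: "bij_betw f {..<q} {..<q}" using inj by (simp add: bij_betw_def)
  have "chi a * (\<Sum>l<q. chi (int l)) = (\<Sum>l<q. chi (int (f l)))"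
    using q_gt_1 by (simp add: sum_distrib_left f_def chi_mod chi_mult)
  also have "\<dots> = (\<Sum>l<q. chi (int l))"
    by (rule sum.reindex_bij_betw[OF bij])
  finally have "(\<Sum>l<q. chi (int l)) = 0" using a1 by simp
  then show ?thesis using sum_lessThan_eq[of "\<lambda>l. chi (int l)"] chi_0 by simp
qed

text \<open>\<open>exceptional_set\<close> is the zero set of this function. For an imprimitive
  character it need not factor into the conjugate of \<open>chi n\<close> and a constant, so it is
  carried as a function of \<open>n\<close>.\<close>

definition gauss_sum :: "int \<Rightarrow> complex" where
  "gauss_sum n = (\<Sum>l=1..q-1. chi (int l) * exp (2 * of_real pi * \<i> * of_int n * of_nat l / of_nat q))"

text \<open>This value removes the pole at 0 from the partial fractions below.\<close>

lemma gauss_sum_0: "gauss_sum 0 = 0"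
  using sum_chi by (simp add: gauss_sum_def)

lemma gauss_sum_add_mult: "gauss_sum (n + k * int q) = gauss_sum n"
proof -
  have "exp (2 * of_real pi * \<i> * of_int (n + k * int q) * of_nat l / of_nat q) =
      exp (2 * of_real pi * \<i> * of_int n * of_nat l / of_nat q)" for l :: nat
  proof -
    have "2 * of_real pi * \<i> * of_int (n + k * int q) * of_nat l / of_nat q =
       2 * of_real pi * \<i> * of_int n * of_nat l / of_nat q + 2 * of_int (k * int l) * of_real pi * \<i>"
      using q_gt_1 by (simp add: field_simps)
    moreover have "exp (2 * of_int (k * int l) * of_real pi * \<i>) = 1"
      by (rule exp_2pi_of_int)
    ultimately show ?thesis by (metis exp_add mult.right_neutral)
  qed
  then show ?thesis by (simp add: gauss_sum_def)
qed

text \<open>Fourier inversion on the residues mod \<open>q\<close>, by orthogonality of the roots of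
  unity. For \<open>j = 0\<close> no summand \<open>l\<close> survives, in agreement with
  \<open>chi 0 = 0\<close>.\<close>

lemma gauss_sum_inversion:
  assumes "j < q"
  shows "(\<Sum>k<q. gauss_sum (int k) * exp (- 2 * of_real pi * \<i> * of_nat k * of_nat j / of_nat q)) =
    of_nat q * chi (int j)"
proof -
  have "(\<Sum>k<q. gauss_sum (int k) * exp (- 2 * of_real pi * \<i> * of_nat k * of_nat j / of_nat q)) =
     (\<Sum>k<q. \<Sum>l=1..q-1. chi (int l) * exp (2 * of_real pi * \<i> * of_nat k * of_int (int l - int j) / of_nat q))"
    unfolding gauss_sum_def sum_distrib_right
    by (intro sum.cong refl) (simp add: mult.assoc exp_add [symmetric] diff_divide_distrib [symmetric] algebra_simps)
  also have "\<dots> = (\<Sum>l=1..q-1. chi (int l) * (\<Sum>k<q. exp (2 * of_real pi * \<i> * of_nat k * of_int (int l - int j) / of_nat q)))"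
    unfolding sum_distrib_left by (rule sum.swap)
  also have "\<dots> = (\<Sum>l=1..q-1. if l = j then of_nat q * chi (int j) else 0)"
  proof (rule sum.cong[OF refl])
    fix l assume l: "l \<in> {1..q-1}"
    have "int q dvd int l - int j \<longleftrightarrow> l = j"
      using l assms by (metis mod_eq_dvd_iff mod_pos_pos_trivial atLeastAtMost_iff diff_self dvd_0_right
        of_nat_0_le_iff of_nat_eq_iff of_nat_less_iff le_less_trans diff_less zero_less_one q_gt_1 less_trans)
    then show "chi (int l) * (\<Sum>k<q. exp (2 * of_real pi * \<i> * of_nat k * of_int (int l - int j) / of_nat q)) =
      (if l = j then of_nat q * chi (int j) else 0)"
      using q_gt_1 sum_roots_of_unity[of q "int l - int j"] by simp
  qed
  also have "\<dots> = of_nat q * chi (int j)"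
    using assms chi_0 by (cases "j = 0") (auto simp: sum.delta)
  finally show ?thesis .
qed

lemma sum_gauss_sum: "(\<Sum>k<q. gauss_sum (int k)) = 0"
  using gauss_sum_inversion[of 0] q_gt_1 chi_0 by simp

text \<open>Substitute \<open>q - l\<close> for \<open>l\<close>. The consequence that matters is
  that the zeros of the Gauss sum are symmetric about 0.\<close>

lemma gauss_sum_minus: "gauss_sum (- n) = chi (- 1) * gauss_sum n"
proof -
  have "gauss_sum (- n) = (\<Sum>l=1..q-1. chi (int (q - l)) * exp (2 * of_real pi * \<i> * of_int (- n) * of_nat (q - l) / of_nat q))"
    unfolding gauss_sum_def
    by (rule sum.reindex_bij_witness[of _ "\<lambda>l. q - l" "\<lambda>l. q - l"]) auto
  also have "\<dots> = (\<Sum>l=1..q-1. chi (- 1) * (chi (int l) * exp (2 * of_real pi * \<i> * of_int n * of_nat l / of_nat q)))"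
  proof (rule sum.cong[OF refl])
    fix l assume "l \<in> {1..q-1}"
    then have l: "l < q" by auto
    have c: "chi (int (q - l)) = chi (- 1) * chi (int l)"
      using l chi_period[of "- int l"] by (simp add: of_nat_diff flip: chi_mult)
    have "2 * of_real pi * \<i> * of_int (- n) * of_nat (q - l) / of_nat q =
       2 * of_real pi * \<i> * of_int n * of_nat l / of_nat q + 2 * of_int (- n) * of_real pi * \<i>"
      using l by (simp add: field_simps of_nat_diff)
    moreover have "exp (2 * of_int (- n) * of_real pi * \<i>) = 1"
      by (rule exp_2pi_of_int)
    ultimately have "exp (2 * of_real pi * \<i> * of_int (- n) * of_nat (q - l) / of_nat q) =
       exp (2 * of_real pi * \<i> * of_int n * of_nat l / of_nat q)"
      by (metis exp_add mult.right_neutral)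
    with c show "chi (int (q - l)) * exp (2 * of_real pi * \<i> * of_int (- n) * of_nat (q - l) / of_nat q) =
      chi (- 1) * (chi (int l) * exp (2 * of_real pi * \<i> * of_int n * of_nat l / of_nat q))"
      by simp
  qed
  finally show ?thesis by (simp add: gauss_sum_def sum_distrib_left)
qed

end

section \<open>Partial fractions\<close>

text \<open>Logarithmic derivative of the reflection formula for Gamma: \<open>d1\<close>
  differentiates the product of Gamma values, \<open>d2\<close> the quotient of pi by the sine, and
  derivatives are unique.\<close>

lemma Digamma_reflection:
  fixes z :: complex
  assumes "sin (of_real pi * z) \<noteq> 0"
  shows "Digamma (1 - z) - Digamma z = of_real pi * cot (of_real pi * z)"
proof -
  have nz: "z \<notin> \<int>"
  proof
    assume "z \<in> \<int>"
    then obtain n where "z = of_int n" by (auto elim: Ints_cases)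
    then have "sin (of_real pi * z) = of_real (sin (pi * of_int n))"
      by (metis of_real_mult of_real_of_int_eq sin_of_real)
    also have "sin (pi * of_int n) = 0"
      by (metis mult.commute sin_zero_iff_int2)
    finally show False using assms by simp
  qed
  have nz1: "z \<notin> \<int>\<^sub>\<le>\<^sub>0" "1 - z \<notin> \<int>\<^sub>\<le>\<^sub>0"
    using nz Ints_diff[of 1 "1 - z"] by (auto dest: nonpos_Ints_Int)
  have d1: "((\<lambda>z. Gamma z * Gamma (1 - z)) has_field_derivative
      Gamma z * Gamma (1 - z) * (Digamma z - Digamma (1 - z))) (at z)"
    using nz1 by (auto intro!: derivative_eq_intros simp: algebra_simps)
  have d2: "((\<lambda>z. Gamma z * Gamma (1 - z)) has_field_derivative
     - (of_real pi)\<^sup>2 * cos (of_real pi * z) / (sin (of_real pi * z))\<^sup>2) (at z)"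
    unfolding Gamma_reflection_complex
    using assms by (auto intro!: derivative_eq_intros simp: power2_eq_square field_simps)
  have eq: "of_real pi / sin (of_real pi * z) * (Digamma z - Digamma (1 - z)) =
      - (of_real pi)\<^sup>2 * cos (of_real pi * z) / (sin (of_real pi * z))\<^sup>2"
    using DERIV_unique[OF d1 d2] by (simp add: Gamma_reflection_complex)
  have "Digamma z - Digamma (1 - z) = sin (of_real pi * z) / of_real pi *
      (of_real pi / sin (of_real pi * z) * (Digamma z - Digamma (1 - z)))"
    using assms by simp
  also have "\<dots> = - of_real pi * cot (of_real pi * z)"
    unfolding eq using assms by (simp add: cot_def field_simps power2_eq_square)
  finally show ?thesis by (simp add: algebra_simps)
qed

lemma sums_Digamma:
  assumes "(z :: complex) \<noteq> 0"
  shows "(\<lambda>j. inverse (of_nat (Suc j)) - inverse (z + of_nat j)) sums (Digamma z + euler_mascheroni)"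
  using summable_sums[OF summable_Digamma[OF assms]] by (simp add: Digamma_def)

text \<open>In this form a cotangent at a point divided by \<open>q\<close> can be expanded into a
  finite geometric sum.\<close>

lemma cot_conv_exp:
  assumes "sin z \<noteq> (0::complex)"
  shows "cot z = \<i> + 2 * \<i> / (exp (2 * \<i> * z) - 1)" "exp (2 * \<i> * z) \<noteq> 1"
proof -
  have e: "exp (2 * \<i> * z) = exp (\<i> * z) * exp (\<i> * z)"
    by (simp add: exp_add [symmetric] mult.assoc)
  have s: "sin z = (exp (\<i> * z) - inverse (exp (\<i> * z))) / (2 * \<i>)"
    by (simp add: sin_exp_eq exp_minus)
  have c: "cos z = (exp (\<i> * z) + inverse (exp (\<i> * z))) / 2"
    by (simp add: cos_exp_eq exp_minus)
  define u where "u = exp (\<i> * z)"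
  have u: "u \<noteq> 0" by (simp add: u_def)
  have s': "sin z = (u * u - 1) / (2 * \<i> * u)"
    unfolding s u_def [symmetric] using u by (simp add: field_simps)
  have c': "cos z = (u * u + 1) / (2 * u)"
    unfolding c u_def [symmetric] using u by (simp add: field_simps)
  have n: "u * u - 1 \<noteq> 0" using assms s' by auto
  show "exp (2 * \<i> * z) \<noteq> 1" using n by (simp add: e u_def)
  show "cot z = \<i> + 2 * \<i> / (exp (2 * \<i> * z) - 1)"
    unfolding cot_def s' c' e u_def [symmetric] using n u by (simp add: field_simps)
qed

text \<open>Here \<open>c\<close> and \<open>d\<close> stand for the Gauss sums at \<open>n\<close>
  and \<open>-n\<close>, \<open>m\<close> for pi n, and the two combinations of \<open>c\<close> and
  \<open>d\<close> on the left are \<open>gauss_cos\<close> and \<open>gauss_sin\<close>.\<close>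

lemma partial_fraction_algebra:
  fixes c d z m :: complex
  assumes "m \<noteq> 0" "z - m \<noteq> 0" "z + m \<noteq> 0"
  shows "(2 * z * ((c + d) / 2) + 2 * \<i> * z\<^sup>2 * ((c - d) / (2 * \<i>)) / m) / (z\<^sup>2 - m\<^sup>2) =
    c / (z - m) + d / (z + m) + (c - d) / m"
proof -
  have e: "z\<^sup>2 - m\<^sup>2 = (z - m) * (z + m)" by (simp add: power2_eq_square algebra_simps)
  show ?thesis unfolding e using assms by (simp add: divide_simps) (simp add: power2_eq_square algebra_simps)
qed

context nonprincipal_character
begin

text \<open>At pi n the numerator is (-1)^n times the Gauss sum at \<open>n\<close>, and the sine
  has derivative (-1)^n there; hence the residue is \<open>gauss_sum n\<close>.\<close>

definition char_csc :: "complex \<Rightarrow> complex" where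
  "char_csc z = (\<Sum>l=1..q-1. chi (int l) * exp (\<i> * of_real (2 * real l / real q - 1) * z)) / sin z"

lemma sin_shift_nonzero:
  assumes "sin z \<noteq> (0::complex)"
  shows "sin ((z - of_real (pi * real_of_int k)) / of_nat q) \<noteq> 0"
proof
  assume "sin ((z - of_real (pi * real_of_int k)) / of_nat q) = 0"
  then obtain n :: int where "(z - of_real (pi * real_of_int k)) / of_nat q = of_real (of_int n * pi)"
    unfolding sin_eq_0 by blast
  then have "z = of_real (real_of_int (k + n * int q) * pi)"
    using q_gt_1 by (simp add: field_simps)
  then show False using assms sin_eq_0 by blast
qed

text \<open>The \<open>k\<close>-th cotangent has its poles at the points pi n with n congruent to
  \<open>k\<close> mod \<open>q\<close>, where the Gauss sum is constant. For the proof, the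
  \<open>q\<close>-th power of \<open>u k\<close> does not depend on \<open>k\<close>, so a
  geometric sum brings all cotangents to one denominator, and the numerators are then an inverse
  Fourier transform.\<close>

lemma char_csc_eq_sum_cot:
  assumes "sin z \<noteq> 0"
  shows "(\<Sum>k<q. gauss_sum (int k) * cot ((z - of_real (pi * real k)) / of_nat q)) = of_nat q * char_csc z"
proof -
  define u where "u k = exp (2 * \<i> * ((z - of_real (pi * real k)) / of_nat q))" for k
  have q0: "of_nat q \<noteq> (0::complex)" using q_gt_1 by simp
  have upow: "u k ^ j = exp (2 * \<i> * z * of_nat j / of_nat q) * exp (- 2 * of_real pi * \<i> * of_nat k * of_nat j / of_nat q)" for k j
    unfolding u_def exp_of_nat_mult [symmetric] exp_add [symmetric]
    using q0 by (intro arg_cong[where f = exp]) (simp add: field_simps)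
  have uq: "u k ^ q = exp (2 * \<i> * z)" for k
  proof -
    have "exp (- 2 * of_real pi * \<i> * of_nat k * of_nat q / of_nat q) = exp (2 * of_int (- int k) * of_real pi * \<i>)"
      using q0 by (intro arg_cong[where f = exp]) simp
    also have "\<dots> = 1" by (rule exp_2pi_of_int)
    finally show ?thesis using q0 unfolding upow by (simp only:) simp
  qed
  have E1: "exp (2 * \<i> * z) \<noteq> 1" using cot_conv_exp[OF assms] by simp
  have cot: "cot ((z - of_real (pi * real k)) / of_nat q) =
      \<i> + 2 * \<i> * (\<Sum>j<q. u k ^ j) / (exp (2 * \<i> * z) - 1)" for k
  proof -
    have s: "sin ((z - of_real (pi * real k)) / of_nat q) \<noteq> 0"
      using sin_shift_nonzero[OF assms, of "int k"] by simp
    have "u k \<noteq> 1" using cot_conv_exp(2)[OF s] by (simp add: u_def)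
    then have "1 / (u k - 1) = (\<Sum>j<q. u k ^ j) / (exp (2 * \<i> * z) - 1)"
      using E1 geometric_sum[of "u k" q] by (simp add: uq field_simps)
    moreover have "cot ((z - of_real (pi * real k)) / of_nat q) = \<i> + 2 * \<i> * (1 / (u k - 1))"
      using cot_conv_exp(1)[OF s] by (simp add: u_def)
    ultimately show ?thesis by simp
  qed
  have "(\<Sum>k<q. gauss_sum (int k) * (\<Sum>j<q. u k ^ j)) =
      (\<Sum>j<q. exp (2 * \<i> * z * of_nat j / of_nat q) *
        (\<Sum>k<q. gauss_sum (int k) * exp (- 2 * of_real pi * \<i> * of_nat k * of_nat j / of_nat q)))"
    unfolding upow sum_distrib_left
    by (subst sum.swap) (simp add: mult_ac)
  also have "\<dots> = (\<Sum>j<q. of_nat q * (chi (int j) * exp (2 * \<i> * z * of_nat j / of_nat q)))"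
    by (intro sum.cong refl) (subst gauss_sum_inversion, auto)
  also have "\<dots> = (\<Sum>j=1..q-1. of_nat q * (chi (int j) * exp (2 * \<i> * z * of_nat j / of_nat q)))"
    by (rule sum_lessThan_eq) (simp add: chi_0)
  also have "\<dots> = of_nat q * exp (\<i> * z) * (\<Sum>l=1..q-1. chi (int l) * exp (\<i> * of_real (2 * real l / real q - 1) * z))"
    unfolding sum_distrib_left
    by (intro sum.cong refl) (simp add: mult.left_commute[of "exp (\<i> * z)"] exp_add [symmetric] algebra_simps)
  finally have S: "(\<Sum>k<q. gauss_sum (int k) * (\<Sum>j<q. u k ^ j)) = \<dots>" .
  define T where "T k = (\<Sum>j<q. u k ^ j)" for k
  have den: "exp (2 * \<i> * z) - 1 = 2 * \<i> * exp (\<i> * z) * sin z"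
  proof -
    have "exp (2 * \<i> * z) = exp (\<i> * z) * exp (\<i> * z)" by (simp add: exp_add [symmetric] mult.assoc)
    then show ?thesis by (simp add: sin_exp_eq exp_minus field_simps)
  qed
  \<comment> \<open>The constant term of each cotangent drops out because the Gauss sums over a
    period add up to zero.\<close>
  have "(\<Sum>k<q. gauss_sum (int k) * cot ((z - of_real (pi * real k)) / of_nat q)) =
     \<i> * (\<Sum>k<q. gauss_sum (int k)) + 2 * \<i> / (exp (2 * \<i> * z) - 1) * (\<Sum>k<q. gauss_sum (int k) * T k)"
    unfolding cot T_def [symmetric] sum_distrib_left by (simp add: sum.distrib [symmetric] algebra_simps)
  also have "\<dots> = of_nat q * char_csc z"
    unfolding T_def S sum_gauss_sum den using assms by (simp add: char_csc_def field_simps)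
  finally show ?thesis .
qed

lemma gauss_sum_minus_eq_diff: "k < q \<Longrightarrow> gauss_sum (- int k) = gauss_sum (int (q - k))"
  using gauss_sum_add_mult[of "- int k" 1] by (simp add: of_nat_diff)

text \<open>
  The terms are grouped by full periods because the ungrouped series converges only conditionally; within a
  period the Gauss sums add up to zero, which cancels the terms \<open>1 / (j + 1)\<close> of the Digamma series.
\<close>

lemma char_csc_sums_blocks:
  assumes "sin z \<noteq> 0"
  shows "(\<lambda>j. \<Sum>n\<in>{j*q..<j*q+q}. gauss_sum (int n) / (z - of_real (pi * real n)) +
      gauss_sum (- int n) / (z + of_real (pi * real n))) sums char_csc z"
proof -
  \<comment> \<open>In this scale the poles lie at the integers, as for Digamma.\<close>
  define x where "x = z / of_real pi"
  have q0: "of_nat q \<noteq> (0::complex)" using q_gt_1 by simp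
  have zx: "z = of_real pi * x" by (simp add: x_def)
  have nz: "x \<noteq> of_int m" for m
  proof
    assume "x = of_int m"
    then have "z = of_real (of_int m * pi)" by (simp add: zx)
    then show False using assms sin_eq_0 by blast
  qed
  have n1: "(of_nat k - x) / of_nat q \<noteq> 0" "(of_nat k + x) / of_nat q \<noteq> 0" for k :: nat
    using nz[of "int k"] nz[of "- int k"] q0 by (auto simp: add_eq_0_iff)
  have sum_gs: "(\<Sum>k=1..q-1. gauss_sum (int k)) = 0"
    using sum_gauss_sum sum_lessThan_eq[of "\<lambda>k. gauss_sum (int k)"] by (simp add: gauss_sum_0)
  \<comment> \<open>Replacing \<open>k\<close> by \<open>q - k\<close> turns
    \<open>(k + x) / q\<close> into \<open>1 - w\<close> with \<open>w = (k - x) / q\<close>, the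
    pair of arguments in the reflection formula.\<close>
  have reidx: "(\<Sum>k=1..q-1. gauss_sum (- int k) * g (int k)) = (\<Sum>k=1..q-1. gauss_sum (int k) * g (int q - int k))" for g :: "int \<Rightarrow> complex"
    by (rule sum.reindex_bij_witness[of _ "\<lambda>l. q - l" "\<lambda>l. q - l"])
       (auto simp: gauss_sum_minus_eq_diff of_nat_diff)
  have sum_gs': "(\<Sum>k=1..q-1. gauss_sum (- int k)) = 0"
    using reidx[of "\<lambda>_. 1"] sum_gs by simp
  define D where "D k = gauss_sum (int k) * (Digamma ((of_nat k - x) / of_nat q) + euler_mascheroni) -
         gauss_sum (- int k) * (Digamma ((of_nat k + x) / of_nat q) + euler_mascheroni)" for k :: nat
  have "(\<lambda>j. \<Sum>k=1..q-1. gauss_sum (int k) * (inverse (of_nat (Suc j)) - inverse ((of_nat k - x) / of_nat q + of_nat j)) -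
     gauss_sum (- int k) * (inverse (of_nat (Suc j)) - inverse ((of_nat k + x) / of_nat q + of_nat j))) sums (\<Sum>k=1..q-1. D k)"
    unfolding D_def by (intro sums_sum sums_diff sums_mult sums_Digamma n1)
  also have "(\<Sum>k=1..q-1. D k) = (\<Sum>k=1..q-1. gauss_sum (int k) * (of_real pi * cot ((z - of_real (pi * real k)) / of_nat q)))"
  proof -
    have "(\<Sum>k=1..q-1. D k) = (\<Sum>k=1..q-1. gauss_sum (int k) * Digamma ((of_nat k - x) / of_nat q)) + (\<Sum>k=1..q-1. gauss_sum (int k)) * euler_mascheroni
       - (\<Sum>k=1..q-1. gauss_sum (- int k) * Digamma ((of_int (int k) + x) / of_nat q)) - (\<Sum>k=1..q-1. gauss_sum (- int k)) * euler_mascheroni"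
      unfolding D_def sum_distrib_right by (simp add: sum.distrib sum_subtractf algebra_simps)
    also have "\<dots> = (\<Sum>k=1..q-1. gauss_sum (int k) * (Digamma ((of_nat k - x) / of_nat q) - Digamma ((of_int (int q - int k) + x) / of_nat q)))"
      unfolding reidx[of "\<lambda>k. Digamma ((of_int k + x) / of_nat q)"] sum_gs sum_gs'
      by (simp add: sum_subtractf algebra_simps)
    also have "\<dots> = (\<Sum>k=1..q-1. gauss_sum (int k) * (of_real pi * cot ((z - of_real (pi * real k)) / of_nat q)))"
    proof (rule sum.cong[OF refl])
      fix k assume "k \<in> {1..q-1}"
      define w where "w = (of_nat k - x) / of_nat q"
      have w1: "(of_int (int q - int k) + x) / of_nat q = 1 - w"
        using q0 by (simp add: w_def field_simps)
      have w2: "of_real pi * w = - ((z - of_real (pi * real k)) / of_nat q)"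
        by (simp add: w_def zx diff_divide_distrib algebra_simps)
      have "sin (of_real pi * w) \<noteq> 0"
        unfolding w2 sin_minus using sin_shift_nonzero[OF assms, of "int k"] by simp
      then have "Digamma (1 - w) - Digamma w = of_real pi * cot (of_real pi * w)"
        by (rule Digamma_reflection)
      also have "cot (of_real pi * w) = - cot ((z - of_real (pi * real k)) / of_nat q)"
        unfolding w2 by (simp add: cot_def)
      finally have "Digamma w - Digamma (1 - w) = of_real pi * cot ((z - of_real (pi * real k)) / of_nat q)"
        by (simp add: algebra_simps)
      then show "gauss_sum (int k) * (Digamma ((of_nat k - x) / of_nat q) - Digamma ((of_int (int q - int k) + x) / of_nat q)) =
         gauss_sum (int k) * (of_real pi * cot ((z - of_real (pi * real k)) / of_nat q))"
        unfolding w1 by (simp add: w_def)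
    qed
    finally show ?thesis .
  qed
  also have "\<dots> = of_real pi * of_nat q * char_csc z"
    unfolding mult.assoc char_csc_eq_sum_cot[OF assms, symmetric]
    by (subst sum_lessThan_eq) (auto simp: gauss_sum_0 sum_distrib_left mult_ac)
  also have "(\<lambda>j. \<Sum>k=1..q-1. gauss_sum (int k) * (inverse (of_nat (Suc j)) - inverse ((of_nat k - x) / of_nat q + of_nat j)) -
     gauss_sum (- int k) * (inverse (of_nat (Suc j)) - inverse ((of_nat k + x) / of_nat q + of_nat j))) =
     (\<lambda>j. of_real pi * of_nat q * (\<Sum>n\<in>{j*q..<j*q+q}. gauss_sum (int n) / (z - of_real (pi * real n)) +
      gauss_sum (- int n) / (z + of_real (pi * real n))))"
  proof
    fix j :: nat
    have eq: "gauss_sum (int k) * (inverse (of_nat (Suc j)) - inverse ((of_nat k - x) / of_nat q + of_nat j)) -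
     gauss_sum (- int k) * (inverse (of_nat (Suc j)) - inverse ((of_nat k + x) / of_nat q + of_nat j)) =
      gauss_sum (int k) * inverse (of_nat (Suc j)) - gauss_sum (- int k) * inverse (of_nat (Suc j)) +
      of_real pi * of_nat q * (gauss_sum (int (k + j * q)) / (z - of_real (pi * real (k + j * q))) +
      gauss_sum (- int (k + j * q)) / (z + of_real (pi * real (k + j * q))))" for k
    proof -
      have f: "gauss_sum (int (k + j * q)) = gauss_sum (int k)" "gauss_sum (- int (k + j * q)) = gauss_sum (- int k)"
        using gauss_sum_add_mult[of "int k" "int j"] gauss_sum_add_mult[of "- int k" "- int j"] by (auto simp: add_ac)
      have a: "inverse ((of_nat k - x) / of_nat q + of_nat j) = - of_real pi * of_nat q / (z - of_real (pi * real (k + j * q)))"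
      proof -
        have "(of_nat k - x) / of_nat q + of_nat j = (of_nat (k + j * q) - x) / of_nat q"
          using q0 by (simp add: field_simps)
        moreover have "z - of_real (pi * real (k + j * q)) = - (of_real pi * (of_nat (k + j * q) - x))"
          by (simp add: zx algebra_simps)
        ultimately show ?thesis
          by (simp only: inverse_divide) simp
      qed
      have b: "inverse ((of_nat k + x) / of_nat q + of_nat j) = of_real pi * of_nat q / (z + of_real (pi * real (k + j * q)))"
      proof -
        have "(of_nat k + x) / of_nat q + of_nat j = (of_nat (k + j * q) + x) / of_nat q"
          using q0 by (simp add: field_simps)
        moreover have "z + of_real (pi * real (k + j * q)) = (of_real pi * (of_nat (k + j * q) + x))"
          by (simp add: zx algebra_simps)
        ultimately show ?thesis
          by (simp only: inverse_divide) simp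
      qed
      show ?thesis unfolding a b f by (simp add: algebra_simps)
    qed
    have "(\<Sum>n\<in>{j*q..<j*q+q}. gauss_sum (int n) / (z - of_real (pi * real n)) + gauss_sum (- int n) / (z + of_real (pi * real n))) =
       (\<Sum>k<q. gauss_sum (int (k + j * q)) / (z - of_real (pi * real (k + j * q))) +
      gauss_sum (- int (k + j * q)) / (z + of_real (pi * real (k + j * q))))"
      by (rule sum.reindex_bij_witness[of _ "\<lambda>k. k + j * q" "\<lambda>n. n - j * q"]) auto
    also have "\<dots> = (\<Sum>k=1..q-1. gauss_sum (int (k + j * q)) / (z - of_real (pi * real (k + j * q))) +
      gauss_sum (- int (k + j * q)) / (z + of_real (pi * real (k + j * q))))"
      using gauss_sum_add_mult[of 0 "int j"] gauss_sum_add_mult[of 0 "- int j"] by (intro sum_lessThan_eq) (simp add: gauss_sum_0)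
    finally show "(\<Sum>k=1..q-1. gauss_sum (int k) * (inverse (of_nat (Suc j)) - inverse ((of_nat k - x) / of_nat q + of_nat j)) -
     gauss_sum (- int k) * (inverse (of_nat (Suc j)) - inverse ((of_nat k + x) / of_nat q + of_nat j))) =
     of_real pi * of_nat q * (\<Sum>n\<in>{j*q..<j*q+q}. gauss_sum (int n) / (z - of_real (pi * real n)) +
      gauss_sum (- int n) / (z + of_real (pi * real n)))"
      unfolding eq sum.distrib sum_subtractf sum_distrib_right [symmetric] sum_gs sum_gs'
      by (simp add: sum_distrib_left sum.distrib algebra_simps)
  qed
  finally show ?thesis
    using q0 by (subst (asm) sums_mult_iff) auto
qed

text \<open>Even part of the Gauss sum; \<open>gauss_sin\<close> is the odd part divided by the
  imaginary unit. For an even character \<open>gauss_sin\<close> vanishes, for an odd one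
  \<open>gauss_cos\<close> does.\<close>

definition gauss_cos :: "nat \<Rightarrow> complex" where "gauss_cos n = (gauss_sum (int n) + gauss_sum (- int n)) / 2"

definition gauss_sin :: "nat \<Rightarrow> complex" where "gauss_sin n = (gauss_sum (int n) - gauss_sum (- int n)) / (2 * \<i>)"

text \<open>
  The contributions of the poles \<open>\<pi>n\<close> and \<open>-\<pi>n\<close> to \<open>char_csc\<close>, with the value at \<open>0\<close> subtracted to make
  the series absolutely convergent. The term for \<open>n = 0\<close> (where \<open>x / 0 = 0\<close> is used) vanishes.
\<close>

definition pf_term :: "complex \<Rightarrow> nat \<Rightarrow> complex" where
  "pf_term z n = (2 * z * gauss_cos n + 2 * \<i> * z\<^sup>2 * gauss_sin n / of_real (pi * real n)) / (z\<^sup>2 - (of_real (pi * real n))\<^sup>2)"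

definition chi_norm :: real where "chi_norm = (\<Sum>l=1..q-1. norm (chi (int l)))"

lemma chi_norm_nonneg: "chi_norm \<ge> 0"
  by (simp add: chi_norm_def sum_nonneg)

lemma norm_gauss_sum_le: "norm (gauss_sum n) \<le> chi_norm"
proof -
  have "norm (gauss_sum n) \<le> (\<Sum>l=1..q-1. norm (chi (int l) * exp (2 * of_real pi * \<i> * of_int n * of_nat l / of_nat q)))"
    unfolding gauss_sum_def by (rule norm_sum)
  also have "\<dots> = chi_norm"
    unfolding chi_norm_def
    by (intro sum.cong refl) (simp add: norm_mult Re_divide_of_nat)
  finally show ?thesis .
qed

lemma norm_gauss_cos_le: "norm (gauss_cos n) \<le> chi_norm"
  using norm_triangle_ineq[of "gauss_sum (int n)" "gauss_sum (- int n)"] norm_gauss_sum_le[of "int n"] norm_gauss_sum_le[of "- int n"]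
  by (simp add: gauss_cos_def norm_divide)

lemma norm_gauss_sin_le: "norm (gauss_sin n) \<le> chi_norm"
  using norm_triangle_ineq4[of "gauss_sum (int n)" "gauss_sum (- int n)"] norm_gauss_sum_le[of "int n"] norm_gauss_sum_le[of "- int n"]
  by (simp add: gauss_sin_def norm_divide norm_mult)

lemma gauss_cos_0: "gauss_cos 0 = 0" and gauss_sin_0: "gauss_sin 0 = 0"
  by (simp_all add: gauss_cos_def gauss_sin_def gauss_sum_0)

lemma summable_pf_term: "summable (pf_term z)"
proof (rule summable_comparison_test')
  define K where "K = 2 * norm z * chi_norm + 2 * (norm z)\<^sup>2 * chi_norm"
  show "summable (\<lambda>n. K * (1 / real n ^ 2))"
    using inverse_power_summable[of 2, where 'a=real] by (intro summable_mult) (simp add: field_simps)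
  \<comment> \<open>From here on |z| is at most n, and pi^2 >= 9 keeps the denominator at least n^2
    in modulus.\<close>
  fix n assume n: "n \<ge> nat \<lceil>norm z\<rceil> + 1"
  then have n1: "real n \<ge> 1" "real n \<ge> norm z" by linarith+
  have pi3: "pi \<ge> 3" using pi_gt3 by simp
  have pn: "pi * real n \<ge> 1" using mult_mono[of 1 pi 1 "real n"] pi3 n1 by simp
  have sq: "(norm z)\<^sup>2 \<le> (real n)\<^sup>2" using n1 by (simp add: power_mono)
  have "9 \<le> pi\<^sup>2" using power_mono[OF pi3, of 2] by simp
  then have "(pi * real n)\<^sup>2 \<ge> 9 * (real n)\<^sup>2"
    by (simp add: power_mult_distrib mult_right_mono)
  then have "(real n)\<^sup>2 \<le> (pi * real n)\<^sup>2 - (norm z)\<^sup>2"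
    using sq zero_le_power2[of "real n"] by linarith
  also have "\<dots> \<le> norm (z\<^sup>2 - (of_real (pi * real n))\<^sup>2)"
    using norm_triangle_ineq3[of "(of_real (pi * real n))\<^sup>2" "z\<^sup>2"]
    by (simp add: norm_power norm_mult norm_minus_commute power_mult_distrib)
  finally have den: "(real n)\<^sup>2 \<le> norm (z\<^sup>2 - (of_real (pi * real n))\<^sup>2)" .
  have "norm (2 * z * gauss_cos n + 2 * \<i> * z\<^sup>2 * gauss_sin n / of_real (pi * real n)) \<le>
     norm (2 * z * gauss_cos n) + norm (2 * \<i> * z\<^sup>2 * gauss_sin n / of_real (pi * real n))"
    by (rule norm_triangle_ineq)
  also have "norm (2 * z * gauss_cos n) \<le> 2 * norm z * chi_norm"
    using norm_gauss_cos_le[of n] by (simp add: norm_mult mult_left_mono)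
  also have "norm (2 * \<i> * z\<^sup>2 * gauss_sin n / of_real (pi * real n)) = 2 * (norm z)\<^sup>2 * norm (gauss_sin n) / (pi * real n)"
    by (simp add: norm_mult norm_divide norm_power)
  also have "\<dots> \<le> 2 * (norm z)\<^sup>2 * chi_norm / 1"
    using pn norm_gauss_sin_le[of n] chi_norm_nonneg by (intro frac_le mult_left_mono mult_nonneg_nonneg) auto
  finally have "norm (2 * z * gauss_cos n + 2 * \<i> * z\<^sup>2 * gauss_sin n / of_real (pi * real n)) \<le> K"
    by (simp add: K_def)
  then show "norm (pf_term z n) \<le> K * (1 / real n ^ 2)"
    unfolding pf_term_def norm_divide using den n1 chi_norm_nonneg
    by (simp add: K_def) (intro frac_le; simp add: K_def)
qed

text \<open>The last quotient is minus the value of the first two at \<open>z = 0\<close>. For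
  \<open>n = 0\<close> all terms vanish since \<open>gauss_sum 0 = 0\<close>.\<close>

lemma pf_term_eq:
  assumes "sin z \<noteq> 0"
  shows "pf_term z n = gauss_sum (int n) / (z - of_real (pi * real n)) + gauss_sum (- int n) / (z + of_real (pi * real n))
     + (gauss_sum (int n) - gauss_sum (- int n)) / of_real (pi * real n)"
proof (cases "n = 0")
  case True
  then show ?thesis by (simp add: pf_term_def gauss_cos_0 gauss_sum_0)
next
  case False
  have "z \<noteq> of_real (of_int (int n) * pi)" "z \<noteq> of_real (of_int (- int n) * pi)"
    using assms sin_eq_0 by blast+
  then have "z - of_real (pi * real n) \<noteq> 0" "z + of_real (pi * real n) \<noteq> 0"
    by (auto simp: mult.commute add_eq_0_iff)
  then show ?thesis
    using False unfolding pf_term_def gauss_cos_def gauss_sin_def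
    by (intro partial_fraction_algebra) auto
qed

text \<open>
  The constant is the value of \<open>char_csc\<close> (extended continuously) at \<open>0\<close>; it cancels later, so only its
  existence matters.
\<close>

lemma partial_fractions:
  obtains P0 where "\<And>z. sin z \<noteq> 0 \<Longrightarrow> pf_term z sums (char_csc z - P0)"
proof -
  define b where "b j = (\<Sum>n\<in>{j*q..<j*q+q}. (gauss_sum (int n) - gauss_sum (- int n)) / of_real (pi * real n))" for j
  \<comment> \<open>The series \<open>b\<close> does not involve \<open>z\<close>, so the absolutely
    convergent sum and \<open>char_csc z\<close> differ by the same constant for every
    \<open>z\<close>.\<close>
  have main: "b sums (suminf (pf_term z) - char_csc z)" if "sin z \<noteq> 0" for z
  proof -
    have "(\<lambda>j. sum (pf_term z) {j*q..<j*q+q}) sums suminf (pf_term z)"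
      using q_gt_1 by (intro sums_group summable_sums summable_pf_term) auto
    from sums_diff[OF this char_csc_sums_blocks[OF that]]
    show ?thesis unfolding b_def by (simp add: pf_term_eq[OF that] sum_subtractf [symmetric])
  qed
  have "pf_term z sums (char_csc z - (- suminf b))" if "sin z \<noteq> 0" for z
  proof -
    have "suminf (pf_term z) - char_csc z = suminf b"
      using main[OF that] by (simp add: sums_iff)
    then have "suminf (pf_term z) = char_csc z - (- suminf b)" by (simp add: algebra_simps)
    then show ?thesis using summable_sums[OF summable_pf_term[of z]] by simp
  qed
  then show ?thesis by (rule that)
qed

end

section \<open>Mellin integrals over the positive half-line\<close>

text \<open>A restricted space rather than an indicator factor: Fubini and dominated convergence
  then apply to the plain integrands, and pointwise facts are only required for t > 0.\<close>

abbreviation lpos :: "real measure" where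
  "lpos \<equiv> restrict_space lborel {0<..}"

lemma space_lpos [simp]: "space lpos = {0<..}"
  by (simp add: space_restrict_space)

lemma measurable_lpos [intro]:
  "f \<in> borel_measurable borel \<Longrightarrow> f \<in> borel_measurable lpos"
  by (intro measurable_restrict_space1) simp

lemma integrable_lpos_iff:
  fixes f :: "real \<Rightarrow> 'a :: {banach, second_countable_topology}"
  shows "integrable lpos f \<longleftrightarrow> set_integrable lborel {0<..} f"
  by (subst set_integrable_eq) auto

lemma integral_lpos:
  fixes f :: "real \<Rightarrow> 'a :: {banach, second_countable_topology}"
  shows "integral\<^sup>L lpos f = set_lebesgue_integral lborel {0<..} f"
  unfolding set_lebesgue_integral_def by (subst integral_restrict_space) auto

lemma AE_lpos: "(\<And>t. t > 0 \<Longrightarrow> P t) \<Longrightarrow> AE t in lpos. P t"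
  by (rule AE_I2) simp

lemma integral_lpos_cong:
  "(\<And>t. t > 0 \<Longrightarrow> f t = g t) \<Longrightarrow> integral\<^sup>L lpos f = integral\<^sup>L lpos g"
  by (rule Bochner_Integration.integral_cong) auto

lemma integrable_lpos_cong:
  "(\<And>t. t > 0 \<Longrightarrow> f t = g t) \<Longrightarrow> integrable lpos f = integrable lpos g"
  by (rule Bochner_Integration.integrable_cong) auto

interpretation lpos: sigma_finite_measure lpos
  by (rule sigma_finite_measure_restrict_space) (auto intro: sigma_finite_lborel)

text \<open>The principal power jumps across the negative axis, so it is written out separately for
  zero, positive and negative \<open>t\<close>; each formula is visibly measurable.\<close>

lemma borel_measurable_of_real_powr [measurable]:
  "(\<lambda>t. complex_of_real t powr z) \<in> borel_measurable borel"
proof -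
  have eq: "(\<lambda>t. complex_of_real t powr z) =
    (\<lambda>t. if t = 0 then 0 else if t > 0 then exp (z * of_real (ln t)) else exp (z * (of_real (ln (- t)) + \<i> * of_real pi)))"
  proof
    fix t :: real
    consider "t = 0" | "t > 0" | "t < 0" by linarith
    then show "complex_of_real t powr z = (if t = 0 then 0 else if t > 0 then exp (z * of_real (ln t)) else exp (z * (of_real (ln (- t)) + \<i> * of_real pi)))"
    proof cases
      case 3
      have "Ln (- of_real (- t)) = Ln (of_real (- t)) + \<i> * of_real pi"
        using 3 by (subst Ln_minus) (auto simp: Ln_of_real)
      also have "Ln (of_real (- t)) = of_real (ln (- t))"
        using 3 by (intro Ln_of_real) auto
      finally have "Ln (of_real t) = of_real (ln (- t)) + \<i> * of_real pi" by simp
      then show ?thesis using 3 by (simp add: powr_def)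
    qed (simp_all add: powr_def Ln_of_real)
  qed
  show ?thesis unfolding eq by measurable
qed

lemma norm_of_real_powr: "t > 0 \<Longrightarrow> norm (complex_of_real t powr z) = t powr Re z"
  by (simp add: norm_powr_real_powr)

lemma of_real_powr_diff_1:
  "t > 0 \<Longrightarrow> complex_of_real (t powr (a - 1)) = of_real t powr (of_real a - 1)"
  using powr_of_real[of t "a - 1"] by simp

text \<open>Euler's integral after the substitution of c t for t. The indicator is part of
  \<open>g\<close> because the affine substitution is made over the whole line; scaling by c > 0
  preserves the half-line.\<close>

lemma Gamma_integral_scaled:
  assumes z: "Re z > 0" and c: "c > 0"
  shows "integrable lpos (\<lambda>t. of_real t powr (z - 1) * of_real (exp (- c * t)))"
    and "(\<integral>t. of_real t powr (z - 1) * of_real (exp (- c * t)) \<partial>lpos) = Gamma z * of_real c powr (- z)"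
proof -
  let ?h = "\<lambda>t. complex_of_real t powr (z - 1) * of_real (exp (- t))"
  have eq: "(\<lambda>t. complex_of_real t powr (z - 1) / of_real (exp t)) = ?h"
    by (simp add: exp_minus field_simps)
  have meas: "?h \<in> borel_measurable borel" by measurable
  have "set_integrable lebesgue {0<..} ?h"
    using absolutely_integrable_Gamma_integral'[OF z] unfolding eq .
  then have i: "set_integrable lborel {0<..} ?h"
    unfolding set_integrable_def using meas by (subst (asm) integrable_completion) auto
  have v: "set_lebesgue_integral lborel {0<..} ?h = Gamma z"
  proof -
    have "set_lebesgue_integral lborel {0<..} ?h = integral {0<..} ?h"
      using set_borel_integral_eq_integral(2)[OF i] .
    also have "\<dots> = Gamma z"
      using Gamma_integral_complex'[OF z] unfolding eq by (rule integral_unique)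
    finally show ?thesis .
  qed
  define g where "g = (\<lambda>t. indicator {0<..} t *\<^sub>R ?h t)"
  have gi: "integrable lborel g" using i by (simp add: g_def set_integrable_def)
  have gv: "integral\<^sup>L lborel g = Gamma z" using v by (simp add: g_def set_lebesgue_integral_def)
  have gc: "g (0 + c * t) = of_real c powr (z - 1) * (indicator {0<..} t *\<^sub>R (of_real t powr (z - 1) * of_real (exp (- c * t))))" for t
  proof (cases "t > 0")
    case True
    have "complex_of_real (c * t) powr (z - 1) = of_real c powr (z - 1) * of_real t powr (z - 1)"
      unfolding of_real_mult using True c by (intro powr_times_real) auto
    then show ?thesis using True c by (simp add: g_def)
  next
    case False
    then show ?thesis using c by (simp add: g_def zero_less_mult_iff)
  qed
  have c1: "complex_of_real c powr (z - 1) \<noteq> 0" using c by simp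
  have "integrable lborel (\<lambda>t. g (0 + c * t))"
    by (rule lborel_integrable_real_affine) (use gi c in auto)
  then have "set_integrable lborel {0<..} (\<lambda>t. of_real t powr (z - 1) * of_real (exp (- c * t)))"
    unfolding gc set_integrable_def
    using integrable_mult_right[of "inverse (complex_of_real c powr (z - 1))"] c1
    by (fastforce simp: mult.assoc [symmetric])
  then show "integrable lpos (\<lambda>t. of_real t powr (z - 1) * of_real (exp (- c * t)))"
    by (simp add: integrable_lpos_iff)
  have "Gamma z = \<bar>c\<bar> *\<^sub>R (\<integral>t. g (0 + c * t) \<partial>lborel)"
    unfolding gv [symmetric] using c by (intro lborel_integral_real_affine) auto
  also have "\<dots> = of_real c * of_real c powr (z - 1) * (\<integral>t. of_real t powr (z - 1) * of_real (exp (- c * t)) \<partial>lpos)"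
    unfolding gc integral_lpos set_lebesgue_integral_def using c by (simp add: scaleR_conv_of_real)
  also have "of_real c * of_real c powr (z - 1) = complex_of_real c powr z"
    using c by (simp add: powr_diff)
  finally show "(\<integral>t. of_real t powr (z - 1) * of_real (exp (- c * t)) \<partial>lpos) = Gamma z * of_real c powr (- z)"
    using c by (simp add: powr_minus field_simps)
qed

text \<open>Write 1 / (x + b) as the integral of exp(-u (x + b)) over u > 0 and exchange the
  integrations. Both iterated integrals are Euler integrals, which leaves Gamma(z) Gamma(1 - z),
  evaluated by reflection.\<close>

lemma integral_powr_over_add:
  fixes z :: complex
  assumes z: "0 < Re z" "Re z < 1" and b: "b > 0"
  shows "integrable lpos (\<lambda>x. of_real x powr (z - 1) / of_real (x + b))"
    and "(\<integral>x. of_real x powr (z - 1) / of_real (x + b) \<partial>lpos) =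
      of_real pi / sin (of_real pi * z) * of_real b powr (z - 1)"
proof -
  interpret P: pair_sigma_finite lpos lpos ..
  define f where "f u x = complex_of_real x powr (z - 1) * of_real (exp (- u * x)) * of_real (exp (- b * u))" for u x :: real
  have meas: "case_prod f \<in> borel_measurable (lpos \<Otimes>\<^sub>M lpos)"
  proof -
    have "case_prod f \<in> borel_measurable (borel \<Otimes>\<^sub>M borel)"
      unfolding f_def case_prod_beta by measurable
    moreover have "(\<lambda>x. x) \<in> measurable (lpos \<Otimes>\<^sub>M lpos) (borel \<Otimes>\<^sub>M borel)"
      unfolding measurable_pair_iff by (auto simp: comp_def intro!: measurable_compose[OF measurable_fst] measurable_compose[OF measurable_snd])
    ultimately show ?thesis by (rule measurable_compose[rotated])
  qed
  have inner: "integrable lpos (f u)" "(\<integral>x. f u x \<partial>lpos) = Gamma z * (of_real u powr ((1 - z) - 1) * of_real (exp (- b * u)))"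
    if "u > 0" for u
  proof -
    show "integrable lpos (f u)"
      unfolding f_def using Gamma_integral_scaled(1)[OF z(1) that] by (intro integrable_mult_left) auto
    show "(\<integral>x. f u x \<partial>lpos) = Gamma z * (of_real u powr ((1 - z) - 1) * of_real (exp (- b * u)))"
      unfolding f_def using Gamma_integral_scaled(2)[OF z(1) that] by simp
  qed
  have rz: "Re (complex_of_real (Re z)) > 0" "Re (1 - complex_of_real (Re z)) > 0" "Re (1 - z) > 0" using z by auto
  have nrm: "norm (f u x) = x powr (Re z - 1) * exp (- u * x) * exp (- b * u)" if "u > 0" "x > 0" for u x
    using that by (simp add: f_def norm_mult norm_of_real_powr)
  \<comment> \<open>The norm of the integrand is the same integrand with \<open>Re z\<close> in
    place of \<open>z\<close>, so the inner integral of the norms is again a Gamma integral.\<close>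
  have nint: "(\<integral>x. norm (f u x) \<partial>lpos) = Re (Gamma (of_real (Re z)) * (of_real u powr (1 - of_real (Re z) - 1) * of_real (exp (- b * u))))"
    if u: "u > 0" for u
  proof -
    have "complex_of_real (\<integral>x. norm (f u x) \<partial>lpos) = (\<integral>x. of_real (norm (f u x)) \<partial>lpos)"
      by simp
    also have "\<dots> = (\<integral>x. of_real x powr (of_real (Re z) - 1) * of_real (exp (- u * x)) * of_real (exp (- b * u)) \<partial>lpos)"
      using u by (intro integral_lpos_cong) (simp add: nrm of_real_powr_diff_1)
    also have "\<dots> = Gamma (of_real (Re z)) * (of_real u powr (1 - of_real (Re z) - 1) * of_real (exp (- b * u)))"
      using Gamma_integral_scaled(2)[OF rz(1) u] by simp
    finally show ?thesis by (metis Re_complex_of_real)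
  qed
  have int: "integrable (lpos \<Otimes>\<^sub>M lpos) (case_prod f)"
  proof (rule P.Fubini_integrable[OF meas])
    have "integrable lpos (\<lambda>u. Re (Gamma (of_real (Re z)) * (of_real u powr (1 - of_real (Re z) - 1) * of_real (exp (- b * u)))))"
      using Gamma_integral_scaled(1)[OF rz(2) b] by (intro integrable_Re integrable_mult_right) auto
    then show "integrable lpos (\<lambda>u. \<integral>x. norm (case (u, x) of (u, x) \<Rightarrow> f u x) \<partial>lpos)"
      by (subst integrable_lpos_cong[OF _]) (auto simp: nint)
    show "AE u in lpos. integrable lpos (\<lambda>x. case (u, x) of (u, x) \<Rightarrow> f u x)"
      using inner by (intro AE_lpos) auto
  qed
  have outer: "(\<integral>u. f u x \<partial>lpos) = of_real x powr (z - 1) / of_real (x + b)" if "x > 0" for x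
  proof -
    have xb: "x + b > 0" using that b by simp
    \<comment> \<open>The plain exponential integral, read as a Gamma integral with exponent
      parameter 1.\<close>
    have "(\<integral>u. of_real u powr (1 - 1) * of_real (exp (- (x + b) * u)) \<partial>lpos) = Gamma 1 * of_real (x + b) powr (- 1 :: complex)"
      by (rule Gamma_integral_scaled) (use xb in auto)
    also have "(\<integral>u. of_real u powr (1 - 1) * of_real (exp (- (x + b) * u)) \<partial>lpos) = (\<integral>u. of_real (exp (- (x + b) * u)) \<partial>lpos)"
      by (rule integral_lpos_cong) simp
    finally have "(\<integral>u. of_real (exp (- (x + b) * u)) \<partial>lpos) = complex_of_real (1 / (x + b))"
      using xb by (simp add: powr_minus field_simps)
    moreover have "(\<integral>u. f u x \<partial>lpos) = (\<integral>u. of_real x powr (z - 1) * of_real (exp (- (x + b) * u)) \<partial>lpos)"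
      unfolding f_def by (intro integral_lpos_cong) (simp add: exp_add [symmetric] algebra_simps flip: of_real_mult)
    ultimately show ?thesis by simp
  qed
  show "integrable lpos (\<lambda>x. of_real x powr (z - 1) / of_real (x + b))"
    using P.integrable_snd[OF int]
    by (subst integrable_lpos_cong[where g = "\<lambda>x. \<integral>u. f u x \<partial>lpos"]) (simp_all add: outer)
  have "(\<integral>x. of_real x powr (z - 1) / of_real (x + b) \<partial>lpos) = (\<integral>x. (\<integral>u. f u x \<partial>lpos) \<partial>lpos)"
    by (intro integral_lpos_cong) (simp add: outer)
  also have "\<dots> = (\<integral>u. (\<integral>x. f u x \<partial>lpos) \<partial>lpos)"
    by (rule P.Fubini_integral[OF int])
  also have "\<dots> = (\<integral>u. Gamma z * (of_real u powr ((1 - z) - 1) * of_real (exp (- b * u))) \<partial>lpos)"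
    by (intro integral_lpos_cong inner)
  also have "\<dots> = Gamma z * (Gamma (1 - z) * of_real b powr (- (1 - z)))"
    using Gamma_integral_scaled[OF rz(3) b] by simp
  also have "\<dots> = of_real pi / sin (of_real pi * z) * of_real b powr (z - 1)"
    using Gamma_reflection_complex[of z] by (simp add: mult.assoc [symmetric])
  finally show "(\<integral>x. of_real x powr (z - 1) / of_real (x + b) \<partial>lpos) =
      of_real pi / sin (of_real pi * z) * of_real b powr (z - 1)" .
qed

lemma of_real_square_powr:
  "t > 0 \<Longrightarrow> complex_of_real (t\<^sup>2) powr z = of_real t powr (2 * z)"
  unfolding power2_eq_square of_real_mult
  by (subst powr_times_real) (auto simp: powr_add [symmetric])

text \<open>Comparison with the preceding integrand at the exponent \<open>Re w / 2\<close> and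
  \<open>b = 1\<close>. Integrability is established first because the substitution rule used next
  asks for it on both sides.\<close>

lemma integrable_powr_over_squares:
  fixes w :: complex
  assumes w: "0 < Re w" "Re w < 2" and a: "a > 0"
  shows "integrable lpos (\<lambda>t. of_real t powr (w - 1) / of_real (t\<^sup>2 + a\<^sup>2))"
proof (rule Bochner_Integration.integrable_bound)
  \<comment> \<open>Chosen so that both \<open>C\<close> and \<open>C * a^2\<close> are at least 2:
    the first is used for t > 1, the second for t <= 1.\<close>
  define C where "C = 2 + 2 / a\<^sup>2"
  show "integrable lpos (\<lambda>t. of_real C * (of_real t powr (of_real (Re w / 2) - 1) / of_real (t + 1)) :: complex)"
    by (intro integrable_mult_right integral_powr_over_add) (use w in auto)
  show "(\<lambda>t. of_real t powr (w - 1) / of_real (t\<^sup>2 + a\<^sup>2)) \<in> borel_measurable lpos"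
    by (rule measurable_lpos) measurable
  show "AE t in lpos. norm (of_real t powr (w - 1) / of_real (t\<^sup>2 + a\<^sup>2) :: complex) \<le>
     norm (of_real C * (of_real t powr (of_real (Re w / 2) - 1) / of_real (t + 1)) :: complex)"
  proof (rule AE_lpos)
    fix t :: real assume t: "t > 0"
    have C2: "C \<ge> 2" "C * a\<^sup>2 \<ge> 2" using a by (simp_all add: C_def field_simps)
    have ta: "t\<^sup>2 + a\<^sup>2 > 0" using a t by (simp add: add_pos_pos)
    have key: "t powr (Re w / 2) * (t + 1) \<le> C * (t\<^sup>2 + a\<^sup>2)"
    proof (cases "t \<le> 1")
      case True
      have "t powr (Re w / 2) \<le> 1" using True t w by (intro powr_le1) auto
      then have "t powr (Re w / 2) * (t + 1) \<le> 1 * 2"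
        using True t by (intro mult_mono) auto
      also have "\<dots> \<le> C * a\<^sup>2" using C2 by simp
      also have "\<dots> \<le> C * (t\<^sup>2 + a\<^sup>2)" using C2 by (intro mult_left_mono) auto
      finally show ?thesis .
    next
      case False
      have "t powr (Re w / 2) \<le> t powr 1" using False w by (intro powr_mono) auto
      then have "t powr (Re w / 2) * (t + 1) \<le> t * (2 * t)"
        using False t by (intro mult_mono) auto
      also have "\<dots> \<le> C * t\<^sup>2" using C2 t by (simp add: power2_eq_square)
      also have "\<dots> \<le> C * (t\<^sup>2 + a\<^sup>2)" using C2 by (intro mult_left_mono) auto
      finally show ?thesis .
    qed
    have split: "t powr (Re w - 1) = t powr (Re w / 2 - 1) * t powr (Re w / 2)"
      by (simp add: powr_add [symmetric])
    have "t powr (Re w - 1) / (t\<^sup>2 + a\<^sup>2) \<le> C * (t powr (Re w / 2 - 1) / (t + 1))"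
    proof -
      have "t powr (Re w / 2 - 1) * (t powr (Re w / 2) * (t + 1)) \<le> t powr (Re w / 2 - 1) * (C * (t\<^sup>2 + a\<^sup>2))"
        by (intro mult_left_mono key) auto
      then show ?thesis unfolding split using ta t by (simp add: field_simps)
    qed
    moreover have "norm (of_real t powr (w - 1) / of_real (t\<^sup>2 + a\<^sup>2) :: complex) = t powr (Re w - 1) / (t\<^sup>2 + a\<^sup>2)"
      using t ta by (simp add: norm_divide norm_of_real_powr del: of_real_add of_real_power)
    moreover have "norm (of_real C * (of_real t powr (of_real (Re w / 2) - 1) / of_real (t + 1)) :: complex) = C * (t powr (Re w / 2 - 1) / (t + 1))"
      using t C2 by (simp add: norm_divide norm_mult norm_of_real_powr del: of_real_add)
    ultimately show "norm (of_real t powr (w - 1) / of_real (t\<^sup>2 + a\<^sup>2) :: complex) \<le>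
     norm (of_real C * (of_real t powr (of_real (Re w / 2) - 1) / of_real (t + 1)) :: complex)" by simp
  qed
qed

text \<open>Substitution x = t^2 in \<open>integral_powr_over_add\<close> at
  \<open>z = w / 2\<close>, \<open>b = a^2\<close>. The range of \<open>w\<close> covers both
  \<open>s\<close> and \<open>s + 1\<close> for \<open>s\<close> in the critical strip.\<close>

lemma integral_powr_over_squares:
  fixes w :: complex
  assumes w: "0 < Re w" "Re w < 2" and a: "a > 0"
  shows "(\<integral>t. of_real t powr (w - 1) / of_real (t\<^sup>2 + a\<^sup>2) \<partial>lpos) =
    of_real pi / (2 * sin (of_real pi * w / 2)) * of_real a powr (w - 2)"
proof -
  define f where "f x = complex_of_real x powr (w / 2 - 1) / of_real (x + a\<^sup>2)" for x :: real
  have a2: "a\<^sup>2 > 0" using a by simp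
  have ei: "einterval 0 \<infinity> = {0<..}" by (auto simp: einterval_def)
  have f: "integrable lpos f" "integral\<^sup>L lpos f = of_real pi / sin (of_real pi * (w / 2)) * of_real (a\<^sup>2) powr (w / 2 - 1)"
    unfolding f_def using integral_powr_over_add[of "w / 2" "a\<^sup>2"] w a2 by simp_all
  have sub: "(2 * t) *\<^sub>R f (t\<^sup>2) = 2 * (of_real t powr (w - 1) / of_real (t\<^sup>2 + a\<^sup>2))" if "t > 0" for t
  proof -
    have "complex_of_real (t\<^sup>2) powr (w / 2 - 1) = of_real t powr (2 * (w / 2 - 1))"
      using that by (rule of_real_square_powr)
    also have "2 * (w / 2 - 1) = w - 1 - 1" by simp
    also have "complex_of_real t powr (w - 1 - 1) = of_real t powr (w - 1) / of_real t"
      using that by (simp add: powr_diff power2_eq_square)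
    finally have "complex_of_real (t\<^sup>2) powr (w / 2 - 1) = of_real t powr (w - 1) / of_real t" .
    then show ?thesis using that unfolding f_def by (simp add: scaleR_conv_of_real)
  qed
  have "(LBINT x=0..\<infinity>. f x) = (LBINT t=0..\<infinity>. (2 * t) *\<^sub>R f (t\<^sup>2))"
  proof (rule interval_integral_substitution_integrable)
    show "(0::ereal) < \<infinity>" by simp
    show "((\<lambda>t. t\<^sup>2) has_real_derivative 2 * x) (at x)" for x :: real
      by (auto intro!: derivative_eq_intros)
    show "isCont f (x\<^sup>2)" if "0 < ereal x" for x
    proof -
      have "x > 0" using that by simp
      then have "complex_of_real (x\<^sup>2) \<notin> \<real>\<^sub>\<le>\<^sub>0" by (simp add: complex_nonpos_Reals_iff)
      moreover have "x\<^sup>2 + a\<^sup>2 > 0" using a2 by (simp add: add_nonneg_pos)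
      then have "complex_of_real (x\<^sup>2 + a\<^sup>2) \<noteq> 0" by (metis of_real_eq_0_iff less_irrefl)
      ultimately show ?thesis unfolding f_def by (intro continuous_intros) auto
    qed
    show "isCont (\<lambda>x. 2 * x) x" for x :: real by (intro continuous_intros)
    show "0 \<le> 2 * x" if "0 \<le> ereal x" for x using that by simp
    show "((ereal \<circ> (\<lambda>t. t\<^sup>2) \<circ> real_of_ereal) \<longlongrightarrow> 0) (at_right 0)"
    proof -
      have "((\<lambda>x. ereal (x\<^sup>2)) \<longlongrightarrow> ereal (0\<^sup>2)) (at_right (0::real))"
        by (intro tendsto_intros)
      then show ?thesis unfolding zero_ereal_def ereal_tendsto_simps by (simp add: zero_ereal_def)
    qed
    show "((ereal \<circ> (\<lambda>t. t\<^sup>2) \<circ> real_of_ereal) \<longlongrightarrow> \<infinity>) (at_left \<infinity>)"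
    proof -
      have "filterlim (\<lambda>x::real. x\<^sup>2) at_top at_top"
        by (rule filterlim_pow_at_top) (auto simp: filterlim_ident)
      then show ?thesis unfolding ereal_tendsto_simps by simp
    qed
    show "set_integrable lborel (einterval 0 \<infinity>) (\<lambda>x. (2 * x) *\<^sub>R f (x\<^sup>2))"
      unfolding ei integrable_lpos_iff [symmetric]
      using integrable_mult_right[OF integrable_powr_over_squares[OF w a], of 2]
      by (subst integrable_lpos_cong[OF sub]) auto
    show "set_integrable lborel (einterval 0 \<infinity>) f"
      unfolding ei integrable_lpos_iff [symmetric] by (rule f)
  qed
  then have "integral\<^sup>L lpos f = (\<integral>t. (2 * t) *\<^sub>R f (t\<^sup>2) \<partial>lpos)"
    by (simp add: interval_lebesgue_integral_def integral_lpos ei)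
  also have "\<dots> = (\<integral>t. 2 * (of_real t powr (w - 1) / of_real (t\<^sup>2 + a\<^sup>2)) \<partial>lpos)"
    by (rule integral_lpos_cong) (rule sub)
  also have "\<dots> = 2 * (\<integral>t. of_real t powr (w - 1) / of_real (t\<^sup>2 + a\<^sup>2) \<partial>lpos)"
    by (rule integral_mult_right_zero)
  finally have "2 * (\<integral>t. of_real t powr (w - 1) / of_real (t\<^sup>2 + a\<^sup>2) \<partial>lpos) =
    of_real pi / sin (of_real pi * (w / 2)) * of_real (a\<^sup>2) powr (w / 2 - 1)"
    unfolding f(2) by (rule sym)
  moreover have "complex_of_real (a\<^sup>2) powr (w / 2 - 1) = of_real a powr (w - 2)"
    unfolding of_real_square_powr[OF a] by (simp add: algebra_simps)
  ultimately have two: "2 * (\<integral>t. of_real t powr (w - 1) / of_real (t\<^sup>2 + a\<^sup>2) \<partial>lpos) =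
    of_real pi / sin (of_real pi * (w / 2)) * of_real a powr (w - 2)"
    by (simp only:)
  have "(\<integral>t. of_real t powr (w - 1) / of_real (t\<^sup>2 + a\<^sup>2) \<partial>lpos) =
    2 * (\<integral>t. of_real t powr (w - 1) / of_real (t\<^sup>2 + a\<^sup>2) \<partial>lpos) / 2"
    by simp
  then show ?thesis unfolding two by simp
qed

section \<open>The L-function as a Mellin transform\<close>

lemma sum_lessThan_add:
  "(\<Sum>n<p + m. f n) = (\<Sum>n<p. f n) + (\<Sum>r<m. f (p + r))" for f :: "nat \<Rightarrow> 'a :: comm_monoid_add"
  by (induction m) (simp_all add: add.assoc)

text \<open>A partial sum differs from the one ending at the last multiple of \<open>k\<close> by
  fewer than \<open>k\<close> terms, each tending to 0. This passes from sums over full periods to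
  the ordinary Dirichlet series.\<close>

lemma LIMSEQ_from_multiples:
  fixes a :: "nat \<Rightarrow> 'a :: real_normed_vector"
  assumes "a \<longlonglongrightarrow> 0" "(\<lambda>N. sum a {..<N*k}) \<longlonglongrightarrow> L" "k > 0"
  shows "a sums L"
proof -
  have div: "filterlim (\<lambda>M. M div k) at_top sequentially"
    using assms(3) by (rule filterlim_at_top_div_const_nat)
  have r: "(\<lambda>M. \<Sum>r<k. norm (a (M div k * k + r))) \<longlonglongrightarrow> (\<Sum>r<k. norm (0::'a))"
  proof (intro tendsto_sum tendsto_norm)
    fix r
    have "filterlim (\<lambda>n. n * k + r) at_top sequentially"
      using assms(3) by (intro filterlim_subseq) (auto simp: strict_mono_def)
    then have "filterlim (\<lambda>M. M div k * k + r) at_top sequentially"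
      by (rule filterlim_compose[OF _ div])
    then show "(\<lambda>M. a (M div k * k + r)) \<longlonglongrightarrow> 0"
      by (rule filterlim_compose[OF assms(1)])
  qed
  have "(\<lambda>M. sum a {..<M} - sum a {..<M div k * k}) \<longlonglongrightarrow> 0"
  proof (rule Lim_null_comparison)
    show "(\<lambda>M. \<Sum>r<k. norm (a (M div k * k + r))) \<longlonglongrightarrow> 0" using r by simp
    show "\<forall>\<^sub>F M in sequentially. norm (sum a {..<M} - sum a {..<M div k * k}) \<le> (\<Sum>r<k. norm (a (M div k * k + r)))"
    proof (intro always_eventually allI)
      fix M
      have "M = M div k * k + M mod k" by simp
      then have "sum a {..<M} = sum a {..<M div k * k} + (\<Sum>r<M mod k. a (M div k * k + r))"
        by (metis sum_lessThan_add)
      then have "norm (sum a {..<M} - sum a {..<M div k * k}) \<le> (\<Sum>r<M mod k. norm (a (M div k * k + r)))"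
        using norm_sum by simp
      also have "\<dots> \<le> (\<Sum>r<k. norm (a (M div k * k + r)))"
        using assms(3) by (intro sum_mono2) (auto simp: less_imp_le order.strict_trans)
      finally show "norm (sum a {..<M} - sum a {..<M div k * k}) \<le> (\<Sum>r<k. norm (a (M div k * k + r)))" .
    qed
  qed
  from tendsto_add[OF this filterlim_compose[OF assms(2) div]]
  show ?thesis by (simp add: sums_def)
qed

context nonprincipal_character
begin

text \<open>The closed form of \<open>\<Sum>\<^sub>n \<chi>(n) e\<^bsup>-2nt/q\<^esup>\<close>.\<close>

definition theta :: "real \<Rightarrow> complex" where
  "theta t = (\<Sum>l=1..q-1. chi (int l) * of_real (exp (- (2 * real l / real q) * t))) / of_real (1 - exp (- 2 * t))"

lemma borel_measurable_theta [measurable]: "theta \<in> borel_measurable borel"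
  unfolding theta_def by measurable

text \<open>Since the values of \<open>chi\<close> over a period add up to zero, exp(-x) with x =
  2t/q may be subtracted from every exponential. Each difference is at most exp(-x) (1 - exp(-2t))
  in modulus, and the second factor cancels the denominator. So theta is bounded near 0 as well as
  exponentially small at infinity.\<close>

lemma norm_theta_le:
  assumes t: "t > 0"
  shows "norm (theta t) \<le> chi_norm * exp (- (2 / real q) * t)"
proof -
  define x where "x = 2 * t / real q"
  have x: "x > 0" using t q_gt_1 by (simp add: x_def)
  have qx: "real q * x = 2 * t" using q_gt_1 by (simp add: x_def)
  have den: "1 - exp (- 2 * t) > 0" using t by simp
  have "(\<Sum>l=1..q-1. chi (int l) * of_real (exp (- (2 * real l / real q) * t))) =
      (\<Sum>l=1..q-1. chi (int l) * of_real (exp (- (real l * x)) - exp (- x))) + (\<Sum>l=1..q-1. chi (int l)) * of_real (exp (- x))"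
    unfolding sum_distrib_right sum.distrib [symmetric]
    by (intro sum.cong refl) (simp add: x_def algebra_simps)
  also have "\<dots> = (\<Sum>l=1..q-1. chi (int l) * of_real (exp (- (real l * x)) - exp (- x)))"
    by (simp only: sum_chi) simp
  also have "norm \<dots> \<le> (\<Sum>l=1..q-1. norm (chi (int l)) * (exp (- x) * (1 - exp (- 2 * t))))"
  proof (rule sum_norm_le)
    fix l assume l: "l \<in> {1..q-1}"
    have "exp (- (real l * x)) \<le> exp (- x)" using l x by simp
    moreover have "exp (- x) * exp (- 2 * t) \<le> exp (- (real l * x))"
    proof -
      have "real l * x \<le> real q * x" using l x by (intro mult_right_mono) auto
      then show ?thesis using x by (simp add: exp_add [symmetric] qx)
    qed
    ultimately have "\<bar>exp (- (real l * x)) - exp (- x)\<bar> \<le> exp (- x) * (1 - exp (- 2 * t))"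
      by (simp add: algebra_simps)
    then show "norm (chi (int l) * of_real (exp (- (real l * x)) - exp (- x))) \<le> norm (chi (int l)) * (exp (- x) * (1 - exp (- 2 * t)))"
      unfolding norm_mult norm_of_real by (intro mult_left_mono) auto
  qed
  also have "\<dots> = chi_norm * (exp (- x) * (1 - exp (- 2 * t)))"
    by (simp add: chi_norm_def sum_distrib_right)
  finally have "norm (\<Sum>l=1..q-1. chi (int l) * of_real (exp (- (2 * real l / real q) * t))) \<le> chi_norm * exp (- x) * (1 - exp (- 2 * t))"
    by simp
  then have "norm (theta t) \<le> chi_norm * exp (- x)"
    unfolding theta_def norm_divide norm_of_real using den by (simp add: pos_divide_le_eq)
  then show ?thesis by (simp add: x_def)
qed

lemma theta_conv_char_csc:
  assumes t: "t > 0"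
  shows "theta t = \<i> / 2 * char_csc (\<i> * of_real t)" "sin (\<i> * complex_of_real t) \<noteq> 0"
proof -
  define r where "r = exp t"
  have r: "r > 1" using t by (simp add: r_def)
  have s: "sin (\<i> * complex_of_real t) = \<i> * of_real ((r - 1 / r) / 2)"
    using r by (simp add: sin_exp_eq r_def exp_minus exp_of_real [symmetric] field_simps)
  have nz: "r - 1 / r \<noteq> 0" using r by (simp add: field_simps) (metis less_1_mult less_irrefl)
  show "sin (\<i> * complex_of_real t) \<noteq> 0" 
  proof -
    have "complex_of_real ((r - 1 / r) / 2) \<noteq> 0" unfolding of_real_eq_0_iff using nz by simp
    then show ?thesis unfolding s by (metis complex_i_not_zero no_zero_divisors)
  qed
  have e2: "exp (- 2 * t) = 1 / (r * r)"
    by (simp add: r_def exp_minus exp_add [symmetric] field_simps)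
  have e1: "exp (\<i> * of_real (2 * real l / real q - 1) * (\<i> * of_real t)) = of_real r * of_real (exp (- (2 * real l / real q) * t))" for l :: nat
    unfolding r_def of_real_mult [symmetric] exp_add [symmetric]
    by (simp add: exp_of_real [symmetric] algebra_simps)
  have "\<i> / 2 * char_csc (\<i> * of_real t) = (\<Sum>l=1..q-1. chi (int l) * of_real (exp (- (2 * real l / real q) * t))) * (of_real r / of_real (r - 1 / r))"
    unfolding char_csc_def e1 s by (simp add: sum_distrib_right sum_divide_distrib sum_distrib_left mult_ac)
  also have "of_real r / of_real (r - 1 / r) = complex_of_real (1 / (1 - 1 / (r * r)))"
    using r nz by (simp flip: of_real_divide of_real_diff) (simp add: field_simps)
  also have "(\<Sum>l=1..q-1. chi (int l) * of_real (exp (- (2 * real l / real q) * t))) * complex_of_real (1 / (1 - 1 / (r * r))) = theta t"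
    unfolding theta_def e2 by (simp only: of_real_divide of_real_1 times_divide_eq_right mult_1_right)
  finally show "theta t = \<i> / 2 * char_csc (\<i> * of_real t)" ..
qed

definition mellin :: "complex \<Rightarrow> complex" where
  "mellin s = (\<integral>t. of_real t powr (s - 1) * theta t \<partial>lpos)"

lemma integrable_mellin:
  assumes "Re s > 0"
  shows "integrable lpos (\<lambda>t. of_real t powr (s - 1) * theta t)"
proof (rule Bochner_Integration.integrable_bound)
  show "integrable lpos (\<lambda>t. of_real chi_norm * (of_real t powr (s - 1) * of_real (exp (- (2 / real q) * t))) :: complex)"
    using assms q_gt_1 by (intro integrable_mult_right Gamma_integral_scaled) auto
  show "(\<lambda>t. of_real t powr (s - 1) * theta t) \<in> borel_measurable lpos"
    by (rule measurable_lpos) measurable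
  show "AE t in lpos. norm (of_real t powr (s - 1) * theta t) \<le>
      norm (of_real chi_norm * (of_real t powr (s - 1) * of_real (exp (- (2 / real q) * t))) :: complex)"
  proof (rule AE_lpos)
    fix t :: real assume t: "t > 0"
    show "norm (of_real t powr (s - 1) * theta t) \<le>
      norm (of_real chi_norm * (of_real t powr (s - 1) * of_real (exp (- (2 / real q) * t))) :: complex)"
      using mult_left_mono[OF norm_theta_le[OF t], of "norm (complex_of_real t powr (s - 1))"] chi_norm_nonneg
      by (simp add: norm_mult mult_ac)
  qed
qed

text \<open>A shift of \<open>n\<close> by \<open>q\<close> fixes \<open>chi\<close> and multiplies
  the exponential by exp(-2t), so whole periods form a finite geometric sum.\<close>

lemma theta_partial_sum:
  assumes t: "t > 0"
  shows "(\<Sum>n<N*q. chi (int n) * of_real (exp (- (2 * real n / real q) * t))) = theta t * of_real (1 - exp (- 2 * t * real N))"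
proof -
  define a where "a n = chi (int n) * complex_of_real (exp (- (2 * real n / real q) * t))" for n
  have a0: "a 0 = 0" by (simp add: a_def chi_0)
  have shift: "a (l + j * q) = a l * of_real (exp (- 2 * t) ^ j)" for l j
  proof -
    have "chi (int (l + j * q)) = chi (int l)" using chi_add_mult[of "int l" "int j"] by simp
    moreover have "exp (- (2 * real (l + j * q) / real q) * t) = exp (- (2 * real l / real q) * t) * exp (- 2 * t) ^ j"
      unfolding exp_of_nat_mult [symmetric] exp_add [symmetric]
      using q_gt_1 by (simp add: field_simps)
    ultimately show ?thesis by (simp add: a_def)
  qed
  have E: "exp (- 2 * t) \<noteq> 1" using t by simp
  have "(\<Sum>n<N*q. a n) = (\<Sum>j<N. \<Sum>l<q. a (l + j * q))"
  proof -
    have "(\<Sum>n<N*q. a n) = (\<Sum>j<N. sum a {j*q..<j*q+q})"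
      by (rule sum.nat_group [symmetric])
    also have "\<dots> = (\<Sum>j<N. \<Sum>l<q. a (l + j * q))"
    proof (rule sum.cong[OF refl])
      fix j
      show "sum a {j*q..<j*q+q} = (\<Sum>l<q. a (l + j * q))"
        by (rule sum.reindex_bij_witness[of _ "\<lambda>k. k + j * q" "\<lambda>n. n - j * q"]) auto
    qed
    finally show ?thesis .
  qed
  also have "\<dots> = (\<Sum>l<q. a l) * of_real (\<Sum>j<N. exp (- 2 * t) ^ j)"
    by (simp add: shift sum_distrib_left sum_distrib_right)
  also have "(\<Sum>j<N. exp (- 2 * t) ^ j) = (1 - exp (- 2 * t * real N)) / (1 - exp (- 2 * t))"
    unfolding sum_gp_strict using E by (simp add: exp_of_nat_mult [symmetric] mult_ac)
  also have "(\<Sum>l<q. a l) = (\<Sum>l=1..q-1. a l)" by (rule sum_lessThan_eq[of a, OF a0])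
  finally show ?thesis by (simp add: a_def theta_def)
qed

text \<open>
  Only partial sums over full periods are used: by \<open>theta_partial_sum\<close> these are dominated by
  \<open>|\<theta>|\<close>, which justifies the interchange although \<open>L(s, \<chi>)\<close> converges only conditionally.
\<close>

lemma mellin_partial_sums:
  assumes s: "Re s > 0"
  shows "(\<lambda>N. \<Sum>n<N*q. chi (int n) * (Gamma s * of_real (2 * real n / real q) powr (- s))) \<longlonglongrightarrow> mellin s"
proof -
  let ?S = "\<lambda>N t. complex_of_real t powr (s - 1) * (\<Sum>n<N*q. chi (int n) * of_real (exp (- (2 * real n / real q) * t)))"
  have eq: "?S N t = complex_of_real t powr (s - 1) * theta t * of_real (1 - exp (- 2 * t * real N))" if "t > 0" for N t
    using theta_partial_sum[OF that] by simp
  have term_integrable: "integrable lpos (\<lambda>t. chi (int n) * (of_real t powr (s - 1) * of_real (exp (- (2 * real n / real q) * t))))"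
    and term_integral: "(\<integral>t. chi (int n) * (of_real t powr (s - 1) * of_real (exp (- (2 * real n / real q) * t))) \<partial>lpos) =
      chi (int n) * (Gamma s * of_real (2 * real n / real q) powr (- s))" for n
  proof -
    show "integrable lpos (\<lambda>t. chi (int n) * (of_real t powr (s - 1) * of_real (exp (- (2 * real n / real q) * t))))"
      using Gamma_integral_scaled(1)[OF s, of "2 * real n / real q"] q_gt_1
      by (cases "n = 0") (auto simp: chi_0 intro: integrable_mult_right)
    show "(\<integral>t. chi (int n) * (of_real t powr (s - 1) * of_real (exp (- (2 * real n / real q) * t))) \<partial>lpos) =
      chi (int n) * (Gamma s * of_real (2 * real n / real q) powr (- s))"
    proof (cases "n = 0")
      case False
      then have "2 * real n / real q > 0" using q_gt_1 by simp
      from Gamma_integral_scaled(2)[OF s this] show ?thesis by simp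
    qed (simp add: chi_0)
  qed
  have "(\<lambda>N. integral\<^sup>L lpos (?S N)) \<longlonglongrightarrow> mellin s"
    unfolding mellin_def
  proof (rule integral_dominated_convergence)
    show "integrable lpos (\<lambda>t. norm (of_real t powr (s - 1) * theta t))"
      using integrable_mellin[OF s] by (rule integrable_norm)
    show "(\<lambda>t. of_real t powr (s - 1) * theta t) \<in> borel_measurable lpos"
      by (rule measurable_lpos) measurable
    show "?S N \<in> borel_measurable lpos" for N
      by (rule measurable_lpos) measurable
    show "AE t in lpos. (\<lambda>N. ?S N t) \<longlonglongrightarrow> of_real t powr (s - 1) * theta t"
    proof (rule AE_lpos)
      fix t :: real assume t: "t > 0"
      have "(\<lambda>N. exp (- 2 * t) ^ N) \<longlonglongrightarrow> 0"
        using t by (intro LIMSEQ_realpow_zero) auto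
      then have "(\<lambda>N. exp (- 2 * t * real N)) \<longlonglongrightarrow> 0"
        by (simp add: exp_of_nat_mult [symmetric] mult_ac)
      then have "(\<lambda>N. complex_of_real t powr (s - 1) * theta t * of_real (1 - exp (- 2 * t * real N))) \<longlonglongrightarrow>
         of_real t powr (s - 1) * theta t * of_real (1 - 0)"
        by (intro tendsto_intros)
      then show "(\<lambda>N. ?S N t) \<longlonglongrightarrow> of_real t powr (s - 1) * theta t"
        unfolding eq[OF t] by simp
    qed
    show "AE t in lpos. norm (?S N t) \<le> norm (of_real t powr (s - 1) * theta t)" for N
    proof (rule AE_lpos)
      fix t :: real assume t: "t > 0"
      have "\<bar>1 - exp (- 2 * t * real N)\<bar> \<le> 1" using t by simp
      then show "norm (?S N t) \<le> norm (of_real t powr (s - 1) * theta t)"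
        unfolding eq[OF t] norm_mult norm_of_real by (intro mult_left_le) auto
    qed
  qed
  moreover have "integral\<^sup>L lpos (?S N) = (\<Sum>n<N*q. chi (int n) * (Gamma s * of_real (2 * real n / real q) powr (- s)))" for N
  proof -
    have "integral\<^sup>L lpos (?S N) = (\<integral>t. (\<Sum>n<N*q. chi (int n) * (of_real t powr (s - 1) * of_real (exp (- (2 * real n / real q) * t)))) \<partial>lpos)"
      by (intro integral_lpos_cong) (simp add: sum_distrib_left mult_ac)
    also have "\<dots> = (\<Sum>n<N*q. chi (int n) * (Gamma s * of_real (2 * real n / real q) powr (- s)))"
      by (subst Bochner_Integration.integral_sum) (simp_all only: term_integrable term_integral)
    finally show ?thesis .
  qed
  ultimately show ?thesis by simp
qed

lemma norm_chi_le: "norm (chi n) \<le> chi_norm"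
proof (cases "nat (n mod int q) = 0")
  case True
  moreover have "n mod int q \<ge> 0" using q_gt_1 by simp
  ultimately have "n mod int q = 0" by linarith
  then show ?thesis using chi_mod[of n] chi_0 chi_norm_nonneg by simp
next
  case False
  define l where "l = nat (n mod int q)"
  have "n mod int q \<ge> 0" "n mod int q < int q" using q_gt_1 by auto
  then have "int l = n mod int q" "l < q" "l \<noteq> 0"
    using False by (auto simp: l_def nat_less_iff)
  then have l: "int l = n mod int q" "l \<in> {1..q-1}" by auto
  have "norm (chi (int l)) \<le> chi_norm"
    unfolding chi_norm_def using l by (intro member_le_sum) auto
  then show ?thesis using l chi_mod[of n] by simp
qed

text \<open>\<open>Dirichlet_L\<close> is a \<open>suminf\<close>, so convergence of the series has
  to be part of the argument: the sums over full periods converge by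
  \<open>mellin_partial_sums\<close>, and the terms tend to 0.\<close>

lemma mellin_eq:
  assumes s: "Re s > 0"
  shows "mellin s = Gamma s * of_real (2 / real q) powr (- s) * Dirichlet_L chi s"
proof -
  define c where "c = Gamma s * of_real (2 / real q) powr (- s)"
  have c: "c \<noteq> 0" using s q_gt_1 by (auto simp: c_def Gamma_eq_zero_iff elim!: nonpos_Ints_cases)
  define a where "a n = chi (int n) * of_nat n powr (- s)" for n
  have coeff: "chi (int n) * (Gamma s * of_real (2 * real n / real q) powr (- s)) = c * a n" for n
  proof -
    have "complex_of_real (2 * real n / real q) powr (- s) = (of_real (2 / real q) * of_real (real n)) powr (- s)"
      by (simp only: of_real_mult [symmetric] times_divide_eq_left)
    also have "\<dots> = of_real (2 / real q) powr (- s) * of_real (real n) powr (- s)"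
      by (rule powr_times_real) (simp_all only: Reals_of_real Re_complex_of_real, simp_all)
    finally show ?thesis by (simp only: a_def c_def of_real_of_nat_eq mult_ac)
  qed
  have "a \<longlonglongrightarrow> 0"
  proof (rule Lim_null_comparison)
    have "(\<lambda>n. chi_norm * real n powr (- Re s)) \<longlonglongrightarrow> chi_norm * 0"
      using s by (intro tendsto_mult tendsto_const tendsto_neg_powr filterlim_real_sequentially) auto
    then show "(\<lambda>n. chi_norm * real n powr (- Re s)) \<longlonglongrightarrow> 0" by simp
    have "norm (a n) \<le> chi_norm * real n powr (- Re s)" if "n > 0" for n
      using that norm_of_real_powr[of "real n" "- s"] norm_chi_le[of "int n"]
      by (simp add: a_def norm_mult mult_right_mono)
    then show "\<forall>\<^sub>F n in sequentially. norm (a n) \<le> chi_norm * real n powr (- Re s)"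
      by (intro eventually_mono[OF eventually_gt_at_top[of "0::nat"]])
  qed
  moreover have "(\<lambda>N. sum a {..<N*q}) \<longlonglongrightarrow> mellin s / c"
  proof -
    have "(\<lambda>N. c * sum a {..<N*q} / c) \<longlonglongrightarrow> mellin s / c"
      using mellin_partial_sums[OF s] c unfolding coeff sum_distrib_left [symmetric]
      by (intro tendsto_divide tendsto_const) auto
    then show ?thesis using c by simp
  qed
  ultimately have "a sums (mellin s / c)" using q_gt_1 by (intro LIMSEQ_from_multiples[of a q]) auto
  \<comment> \<open>\<open>Dirichlet_L\<close> starts at index 1; nothing is lost because
    \<open>chi 0 = 0\<close>.\<close>
  then have "(\<lambda>n. a (Suc n)) sums (mellin s / c)"
    by (subst sums_Suc_iff) (simp add: a_def chi_0)
  then have "Dirichlet_L chi s = mellin s / c"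
    by (simp add: Dirichlet_L_def a_def sums_iff)
  then have "mellin s = c * Dirichlet_L chi s" using c by simp
  then show ?thesis by (simp only: c_def)
qed

end

section \<open>Evaluation of the difference\<close>

lemma sin_cos_half_nonzero:
  assumes "0 < Re s" "Re s < 1"
  shows "sin (of_real pi * s / 2) \<noteq> 0" "cos (of_real pi * s / 2) \<noteq> 0"
proof -
  have *: "sin (of_real pi * w / 2) \<noteq> 0" if "0 < Re w" "Re w < 2" for w :: complex
  proof
    assume "sin (of_real pi * w / 2) = 0"
    then obtain n :: int where "of_real pi * w / 2 = of_real (of_int n * pi)"
      unfolding sin_eq_0 by blast
    then have "w = of_real (2 * of_int n)" by (simp add: field_simps)
    then have "0 < 2 * real_of_int n" "2 * real_of_int n < 2" using that by simp_all
    then have "0 < n" "n < 1" by simp_all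
    then show False by linarith
  qed
  show "sin (of_real pi * s / 2) \<noteq> 0" using * assms by simp
  have "sin (of_real pi * (s + 1) / 2) = cos (of_real pi * s / 2)"
    by (simp add: distrib_left add_divide_distrib sin_add)
  then show "cos (of_real pi * s / 2) \<noteq> 0" using *[of "s + 1"] assms by simp
qed

text \<open>To be read with a = t^2 + (pi n)^2, b = t^2 + y^2, p = t^(s-1), T = t, M = pi n, and A,
  B the even and odd coefficients. It separates the two quadratic factors through 1/(ab) = (1/a -
  1/b)/(b - a); the factors \<open>b - T^2\<close> and \<open>a - T^2\<close> become y^2 and (pi
  n)^2, free of t.\<close>

lemma two_square_partial_fractions:
  fixes a b p A B M T :: complex
  assumes "a \<noteq> 0" "b \<noteq> 0" "b - a \<noteq> 0" "M \<noteq> 0"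
  shows "p * ((T * A - T\<^sup>2 * B / M) / a) / b = A / (b - a) * (T * p / a - T * p / b)
    - B / M / (b - a) * ((b - T\<^sup>2) * (p / b) - (a - T\<^sup>2) * (p / a))"
proof -
  have 1: "T * p / a - T * p / b = T * p * (b - a) / (a * b)"
    using assms by (simp add: field_simps)
  have 2: "(b - T\<^sup>2) * (p / b) - (a - T\<^sup>2) * (p / a) = T\<^sup>2 * p * (b - a) / (a * b)"
    using assms by (simp add: field_simps)
  have "A / (b - a) * (T * p / a - T * p / b) - B / M / (b - a) * ((b - T\<^sup>2) * (p / b) - (a - T\<^sup>2) * (p / a)) =
     A * T * p / (a * b) - B / M * (T\<^sup>2 * p) / (a * b)"
    unfolding 1 2 using assms(3) by simp
  also have "\<dots> = p * ((T * A - T\<^sup>2 * B / M) / a) / b"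
    by (simp add: diff_divide_distrib right_diff_distrib mult_ac)
  finally show ?thesis ..
qed

section \<open>Termwise expansion of theta\<close>

context nonprincipal_character
begin

definition theta_term :: "nat \<Rightarrow> real \<Rightarrow> complex" where
  "theta_term n t = (of_real t * gauss_cos n - of_real (t\<^sup>2) * gauss_sin n / of_real (pi * real n)) / of_real (t\<^sup>2 + (pi * real n)\<^sup>2)"

lemma theta_term_conv_pf_term: "theta_term n t = \<i> / 2 * pf_term (\<i> * of_real t) n"
proof -
  have neg: "\<i> / 2 * (a / - b) = (- (\<i> / 2) * a) / b" for a b :: complex by simp
  have "(\<i> * of_real t)\<^sup>2 - (of_real (pi * real n))\<^sup>2 = - complex_of_real (t\<^sup>2 + (pi * real n)\<^sup>2)"
    by (simp add: power_mult_distrib)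
  then have "\<i> / 2 * pf_term (\<i> * of_real t) n = \<i> / 2 * ((2 * (\<i> * of_real t) * gauss_cos n + 2 * \<i> * (\<i> * of_real t)\<^sup>2 * gauss_sin n / of_real (pi * real n)) / - complex_of_real (t\<^sup>2 + (pi * real n)\<^sup>2))"
    by (simp only: pf_term_def)
  also have "\<dots> = (- (\<i> / 2) * (2 * (\<i> * of_real t) * gauss_cos n + 2 * \<i> * (\<i> * of_real t)\<^sup>2 * gauss_sin n / of_real (pi * real n))) / of_real (t\<^sup>2 + (pi * real n)\<^sup>2)"
    by (rule neg)
  also have "- (\<i> / 2) * (2 * (\<i> * of_real t) * gauss_cos n + 2 * \<i> * (\<i> * of_real t)\<^sup>2 * gauss_sin n / of_real (pi * real n)) =
      of_real t * gauss_cos n - of_real (t\<^sup>2) * gauss_sin n / of_real (pi * real n)"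
    by (simp add: power_mult_distrib algebra_simps)
  finally show ?thesis by (simp only: theta_term_def)
qed

text \<open>The bound is summable over \<open>n\<close> and grows only linearly in \<open>t\<close>;
  the extra factor t is affordable because t^s / (t^2 + y^2) is still integrable for Re s <
  1.\<close>

lemma norm_theta_term_le:
  assumes t: "t > 0"
  shows "norm (theta_term n t) \<le> 2 * chi_norm / (real n)\<^sup>2 * t"
proof (cases "n = 0")
  case True
  then show ?thesis by (simp add: theta_term_def gauss_cos_0 gauss_sin_0)
next
  case False
  define m where "m = pi * real n"
  have m: "m \<ge> real n" "m > 0" "real n > 0" using False pi_gt3 by (auto simp: m_def)
  have m2: "m\<^sup>2 \<ge> (real n)\<^sup>2" using m by (intro power_mono) auto
  have d: "t\<^sup>2 + m\<^sup>2 > 0" using m by (simp add: add_nonneg_pos)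
  have "norm (theta_term n t) \<le> (t * norm (gauss_cos n) + t\<^sup>2 * norm (gauss_sin n) / m) / (t\<^sup>2 + m\<^sup>2)"
    unfolding theta_term_def m_def [symmetric] norm_divide norm_of_real
    using d m t norm_triangle_ineq4[of "of_real t * gauss_cos n" "of_real (t\<^sup>2) * gauss_sin n / of_real m"]
    by (simp add: norm_mult norm_divide norm_power divide_right_mono)
  also have "\<dots> \<le> (t * chi_norm + t\<^sup>2 * chi_norm / m) / (t\<^sup>2 + m\<^sup>2)"
    using m d t norm_gauss_cos_le[of n] norm_gauss_sin_le[of n]
    by (intro divide_right_mono add_mono mult_left_mono) auto
  also have "\<dots> = t * chi_norm / (t\<^sup>2 + m\<^sup>2) + chi_norm * (t\<^sup>2 / m / (t\<^sup>2 + m\<^sup>2))"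
    by (simp add: add_divide_distrib)
  also have "\<dots> \<le> t * chi_norm / (real n)\<^sup>2 + chi_norm * (t / (real n)\<^sup>2)"
  proof (intro add_mono mult_left_mono chi_norm_nonneg)
    have n2: "(real n)\<^sup>2 \<le> t\<^sup>2 + m\<^sup>2" using m2 by (simp add: add_increasing)
    show "t * chi_norm / (t\<^sup>2 + m\<^sup>2) \<le> t * chi_norm / (real n)\<^sup>2"
      using t m chi_norm_nonneg n2 d by (intro divide_left_mono mult_pos_pos) auto
    define D where "D = t\<^sup>2 + m\<^sup>2"
    have D: "D > 0" using d by (simp add: D_def)
    \<comment> \<open>From 2 t m <= t^2 + m^2; this trades one factor t in the odd term for a factor
      1/m.\<close>
    have tm: "t * m \<le> D"
    proof -
      have "2 * (t * m) \<le> D" using sum_squares_bound[of t m] by (simp add: D_def mult.assoc)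
      moreover have "0 < t * m" using t m by simp
      ultimately show ?thesis by linarith
    qed
    have "t * (real n)\<^sup>2 \<le> t * m\<^sup>2" using m2 t by (intro mult_left_mono) auto
    also have "\<dots> = m * (t * m)" by (simp add: power2_eq_square)
    also have "\<dots> \<le> m * D" using tm m by (intro mult_left_mono) auto
    finally have "t / (m * D) \<le> 1 / (real n)\<^sup>2"
      using m D by (simp add: divide_le_eq le_divide_eq mult.commute)
    then have "t * (t / (m * D)) \<le> t * (1 / (real n)\<^sup>2)"
      using t by (intro mult_left_mono) auto
    then show "t\<^sup>2 / m / (t\<^sup>2 + m\<^sup>2) \<le> t / (real n)\<^sup>2"
      unfolding D_def [symmetric] by (simp add: power2_eq_square)
  qed
  also have "\<dots> = 2 * chi_norm / (real n)\<^sup>2 * t" by (simp add: field_simps)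
  finally show ?thesis .
qed

section \<open>The coefficients and the convergence of the gamma series\<close>

lemma gauss_cos_conv_cos: "gauss_cos n = (\<Sum>l=1..q-1. chi (int l) * of_real (cos (2 * pi * real n * real l / real q)))"
  and gauss_sin_conv_sin: "gauss_sin n = (\<Sum>l=1..q-1. chi (int l) * of_real (sin (2 * pi * real n * real l / real q)))"
proof -
  have e: "exp (2 * of_real pi * \<i> * of_int (int n) * of_nat l / of_nat q) =
      of_real (cos (2 * pi * real n * real l / real q)) + \<i> * of_real (sin (2 * pi * real n * real l / real q))" for l :: nat
  proof -
    have "2 * of_real pi * \<i> * of_int (int n) * of_nat l / of_nat q = \<i> * complex_of_real (2 * pi * real n * real l / real q)"
      by simp
    then show ?thesis by (simp only: exp_Euler cos_of_real sin_of_real)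
  qed
  have e': "exp (2 * of_real pi * \<i> * of_int (- int n) * of_nat l / of_nat q) =
      of_real (cos (2 * pi * real n * real l / real q)) - \<i> * of_real (sin (2 * pi * real n * real l / real q))" for l :: nat
  proof -
    have "2 * of_real pi * \<i> * of_int (- int n) * of_nat l / of_nat q = \<i> * complex_of_real (- (2 * pi * real n * real l / real q))"
      by simp
    then show ?thesis by (simp only: exp_Euler cos_of_real sin_of_real) simp
  qed
  show "gauss_cos n = (\<Sum>l=1..q-1. chi (int l) * of_real (cos (2 * pi * real n * real l / real q)))"
    unfolding gauss_cos_def gauss_sum_def e e' sum.distrib [symmetric] sum_divide_distrib
    by (intro sum.cong refl) (simp add: algebra_simps)
  show "gauss_sin n = (\<Sum>l=1..q-1. chi (int l) * of_real (sin (2 * pi * real n * real l / real q)))"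
    unfolding gauss_sin_def gauss_sum_def e e' sum_subtractf [symmetric] sum_divide_distrib
    by (intro sum.cong refl) (simp add: algebra_simps)
qed

definition gamma_coeff :: "complex \<Rightarrow> nat \<Rightarrow> complex" where
  "gamma_coeff s n = gauss_cos n * sin (of_real pi * s / 2) + gauss_sin n * cos (of_real pi * s / 2)"

lemma gamma_coeff_eq:
  "(\<Sum>l=1..q-1. chi (int l) * sin (of_real (2 * pi * real n * real l / real q) + of_real pi * s / 2)) = gamma_coeff s n"
  unfolding gamma_coeff_def gauss_cos_conv_cos gauss_sin_conv_sin sum_distrib_right sum.distrib [symmetric] sin_add
  by (intro sum.cong refl) (simp only: cos_of_real sin_of_real, simp add: algebra_simps)

text \<open>Uses the symmetry of the zeros of the Gauss sum. It allows the sum in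
  \<open>gamma_fun\<close> to be extended to all \<open>n\<close>.\<close>

lemma gamma_coeff_exceptional: "int n \<in> exceptional_set q chi \<Longrightarrow> gamma_coeff s n = 0"
proof -
  assume "int n \<in> exceptional_set q chi"
  then have "gauss_sum (int n) = 0" by (simp add: exceptional_set_def gauss_sum_def)
  then show ?thesis using gauss_sum_minus[of "int n"] by (simp add: gamma_coeff_def gauss_cos_def gauss_sin_def)
qed

lemma gamma_coeff_0: "gamma_coeff s 0 = 0"
  by (simp add: gamma_coeff_def gauss_cos_0 gauss_sin_0)

text \<open>Absolute convergence identifies the unconditional \<open>infsum\<close> of
  \<open>gamma_fun\<close> with the ordinary series that the later arguments use.\<close>

lemma summable_gamma_terms:
  assumes "Re s < 1"
  shows "summable (\<lambda>n. norm (of_real (pi * real n) powr (s - 1) * gamma_coeff s n * of_real (sin_quotient n y)))"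
proof (rule summable_comparison_test')
  define K where "K = chi_norm * norm (sin (of_real pi * s / 2)) + chi_norm * norm (cos (of_real pi * s / 2))"
  show "summable (\<lambda>n. K * (1 / real n ^ 2))"
    using inverse_power_summable[of 2, where 'a=real] by (intro summable_mult) (simp add: field_simps)
  \<comment> \<open>For these \<open>n\<close> the point \<open>y\<close> is none of the removable
    points pi n, -pi n, so \<open>sin_quotient\<close> is the plain quotient.\<close>
  fix n assume n: "n \<ge> nat \<lceil>\<bar>y\<bar>\<rceil> + 1"
  then have n1: "real n \<ge> 1" "real n \<ge> \<bar>y\<bar>" by linarith+
  have K0: "K \<ge> 0" using chi_norm_nonneg by (simp add: K_def)
  have m1: "pi * real n \<ge> 1" using mult_mono[of 1 pi 1 "real n"] pi_gt3 n1 by simp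
  have c: "norm (gamma_coeff s n) \<le> K"
    unfolding gamma_coeff_def K_def
    using norm_gauss_cos_le[of n] norm_gauss_sin_le[of n]
    by (intro order_trans[OF norm_triangle_ineq] add_mono) (auto simp: norm_mult intro: mult_right_mono)
  have p: "norm (complex_of_real (pi * real n) powr (s - 1)) \<le> 1"
  proof -
    have "norm (complex_of_real (pi * real n) powr (s - 1)) = (pi * real n) powr (Re s - 1)"
      using m1 by (subst norm_of_real_powr) auto
    also have "\<dots> \<le> (pi * real n) powr 0" using assms m1 by (intro powr_mono) auto
    also have "\<dots> = 1" using n1 by auto
    finally show ?thesis .
  qed
  have sq: "y\<^sup>2 \<le> (real n)\<^sup>2" using n1 by (metis abs_le_square_iff abs_of_nat)
  have "9 \<le> pi\<^sup>2" using power_mono[of 3 pi 2] pi_gt3 by simp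
  then have "(pi * real n)\<^sup>2 \<ge> 9 * (real n)\<^sup>2"
    by (simp add: power_mult_distrib mult_right_mono)
  then have d: "(real n)\<^sup>2 \<le> (pi * real n)\<^sup>2 - y\<^sup>2"
    using sq zero_le_power2[of "real n"] by linarith
  have n2: "(real n)\<^sup>2 > 0" using n1 by simp
  have "\<bar>sin_quotient n y\<bar> = \<bar>sin y\<bar> / ((pi * real n)\<^sup>2 - y\<^sup>2)"
  proof -
    have "y\<^sup>2 - (pi * real n)\<^sup>2 < 0" using d n2 by linarith
    moreover from this have "y\<^sup>2 \<noteq> (pi * real n)\<^sup>2" by auto
    ultimately show ?thesis by (simp add: sin_quotient_def)
  qed
  also have "\<dots> \<le> 1 / (real n)\<^sup>2"
    using d n2 by (intro frac_le) auto
  finally have q: "\<bar>sin_quotient n y\<bar> \<le> 1 / (real n)\<^sup>2" .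
  have "norm (of_real (pi * real n) powr (s - 1) * gamma_coeff s n * of_real (sin_quotient n y)) \<le> 1 * K * (1 / (real n)\<^sup>2)"
    unfolding norm_mult norm_of_real using p c q K0 by (intro mult_mono mult_nonneg_nonneg) auto
  then show "norm (norm (of_real (pi * real n) powr (s - 1) * gamma_coeff s n * of_real (sin_quotient n y))) \<le> K * (1 / (real n)\<^sup>2)"
    by simp
qed

lemma gamma_fun_eq_suminf:
  assumes "Re s < 1"
  shows "gamma_fun q chi s y = - (of_real pi * 2 powr s * of_real (y\<^sup>2) / sin (of_real pi * s)) *
    (\<Sum>n. of_real (pi * real n) powr (s - 1) * gamma_coeff s n * of_real (sin_quotient n y))"
proof -
  let ?f = "\<lambda>n. of_real (pi * real n) powr (s - 1) * gamma_coeff s n * of_real (sin_quotient n y)"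
  have "(\<Sum>\<^sub>\<infinity>n\<in>{n::nat. n \<ge> 1 \<and> int n \<notin> exceptional_set q chi}. ?f n) = (\<Sum>\<^sub>\<infinity>n. ?f n)"
  proof (rule infsum_cong_neutral)
    fix n assume "n \<in> UNIV - {n::nat. n \<ge> 1 \<and> int n \<notin> exceptional_set q chi}"
    then have "n = 0 \<or> int n \<in> exceptional_set q chi" by auto
    then have "gamma_coeff s n = 0" using gamma_coeff_exceptional gamma_coeff_0 by blast
    then show "?f n = 0" by simp
  qed auto
  also have "\<dots> = suminf ?f"
    using norm_summable_imp_has_sum[OF summable_gamma_terms[OF assms]] summable_norm_cancel[OF summable_gamma_terms[OF assms]]
    by (intro infsumI) (simp add: summable_sums)
  finally show ?thesis unfolding gamma_fun_def gamma_coeff_eq by (simp only:)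
qed

section \<open>The Stieltjes integral of theta and its resummation\<close>

definition stieltjes :: "complex \<Rightarrow> real \<Rightarrow> complex" where
  "stieltjes s y = (\<integral>t. of_real t powr (s - 1) * theta t / of_real (t\<^sup>2 + y\<^sup>2) \<partial>lpos)"

text \<open>\<open>u\<close> and \<open>v\<close> are the constants in the integrals of t^(s-1) /
  (t^2 + a^2) and t^s / (t^2 + a^2), which are u a^(s-2) and v a^(s-1); the cosine is the sine at
  \<open>s + 1\<close>. They account for the two denominators in \<open>varphi\<close>.\<close>

context
  fixes s :: complex and u v :: complex
  assumes s: "0 < Re s" "Re s < 1"
  defines "u \<equiv> of_real pi / (2 * sin (of_real pi * s / 2))"
    and "v \<equiv> of_real pi / (2 * cos (of_real pi * s / 2))"
begin

lemma squares_integrals: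
  assumes a: "a > 0"
  shows "integrable lpos (\<lambda>t. of_real t powr (s - 1) / of_real (t\<^sup>2 + a\<^sup>2))"
    and "(\<integral>t. of_real t powr (s - 1) / of_real (t\<^sup>2 + a\<^sup>2) \<partial>lpos) = u * of_real a powr (s - 2)"
    and "integrable lpos (\<lambda>t. of_real t * of_real t powr (s - 1) / of_real (t\<^sup>2 + a\<^sup>2))"
    and "(\<integral>t. of_real t * of_real t powr (s - 1) / of_real (t\<^sup>2 + a\<^sup>2) \<partial>lpos) = v * (of_real a * of_real a powr (s - 2))"
proof -
  show "integrable lpos (\<lambda>t. of_real t powr (s - 1) / of_real (t\<^sup>2 + a\<^sup>2))"
    using s a by (intro integrable_powr_over_squares) auto
  show "(\<integral>t. of_real t powr (s - 1) / of_real (t\<^sup>2 + a\<^sup>2) \<partial>lpos) = u * of_real a powr (s - 2)"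
    unfolding u_def using s a by (intro integral_powr_over_squares) auto
  have eq: "complex_of_real t powr (s + 1 - 1) / of_real (t\<^sup>2 + a\<^sup>2) = of_real t * of_real t powr (s - 1) / of_real (t\<^sup>2 + a\<^sup>2)" if "t > 0" for t
    using that by (simp add: powr_diff)
  have "integrable lpos (\<lambda>t. of_real t powr (s + 1 - 1) / of_real (t\<^sup>2 + a\<^sup>2))"
    using s a by (intro integrable_powr_over_squares) auto
  then show "integrable lpos (\<lambda>t. of_real t * of_real t powr (s - 1) / of_real (t\<^sup>2 + a\<^sup>2))"
    by (subst (asm) integrable_lpos_cong[OF eq]) auto
  have sc: "sin (of_real pi * (s + 1) / 2) = cos (of_real pi * s / 2)"
    by (simp add: distrib_left add_divide_distrib sin_add)
  have pw: "complex_of_real a powr (s + 1 - 2) = of_real a * of_real a powr (s - 2)"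
    using a by (simp add: powr_diff power2_eq_square)
  have "(\<integral>t. of_real t powr (s + 1 - 1) / of_real (t\<^sup>2 + a\<^sup>2) \<partial>lpos) =
     of_real pi / (2 * sin (of_real pi * (s + 1) / 2)) * of_real a powr (s + 1 - 2)"
    using s a by (intro integral_powr_over_squares) auto
  then show "(\<integral>t. of_real t * of_real t powr (s - 1) / of_real (t\<^sup>2 + a\<^sup>2) \<partial>lpos) = v * (of_real a * of_real a powr (s - 2))"
    unfolding sc pw v_def [symmetric] by (subst (asm) integral_lpos_cong[OF eq]) auto
qed

text \<open>Up to the factor sin(y) sin(pi s) / pi, the \<open>n\<close>-th summand of the gamma
  series at y > 0 with sin(y) nonzero.\<close>

definition stieltjes_term :: "real \<Rightarrow> nat \<Rightarrow> complex" where
  "stieltjes_term y n = of_real (pi * real n) powr (s - 1) * (v * gauss_cos n + u * gauss_sin n) / of_real (y\<^sup>2 - (pi * real n)\<^sup>2)"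

text \<open>After separating the two quadratic factors, the part with (pi n)^2 gives
  \<open>stieltjes_term\<close>, and the part with y^2 gives y^(s-2) times a rational function of y,
  written through \<open>pf_term\<close> at y and -y so that its sum over \<open>n\<close> is
  known.\<close>

lemma integral_theta_term:
  assumes y: "y > 0" and ne: "y \<noteq> pi * real n"
  shows "integrable lpos (\<lambda>t. of_real t powr (s - 1) * theta_term n t / of_real (t\<^sup>2 + y\<^sup>2))"
    and "(\<integral>t. of_real t powr (s - 1) * theta_term n t / of_real (t\<^sup>2 + y\<^sup>2) \<partial>lpos) =
      stieltjes_term y n - of_real y powr (s - 2) *
        (v * ((pf_term (of_real y) n - pf_term (- of_real y) n) / 4) +
         u * ((pf_term (of_real y) n + pf_term (- of_real y) n) / (4 * \<i>)))"
proof -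
  let ?f = "\<lambda>t. complex_of_real t powr (s - 1) * theta_term n t / of_real (t\<^sup>2 + y\<^sup>2)"
  let ?R = "stieltjes_term y n - of_real y powr (s - 2) *
        (v * ((pf_term (of_real y) n - pf_term (- of_real y) n) / 4) +
         u * ((pf_term (of_real y) n + pf_term (- of_real y) n) / (4 * \<i>)))"
  have "integrable lpos ?f \<and> integral\<^sup>L lpos ?f = ?R"
  proof (cases "n = 0")
    case True
    then show ?thesis by (simp add: theta_term_def stieltjes_term_def pf_term_def gauss_cos_0 gauss_sin_0)
  next
    case False
    define m where "m = pi * real n"
    define A B d where "A = gauss_cos n" and "B = gauss_sin n" and "d = complex_of_real (y\<^sup>2 - m\<^sup>2)"
    define M Y where "M = complex_of_real m" and "Y = complex_of_real y"
    have m: "m > 0" using False by (simp add: m_def)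
    have d: "d \<noteq> 0" using y m ne by (simp add: d_def m_def power2_eq_iff flip: of_real_power)
    have M: "M \<noteq> 0" "Y \<noteq> 0" using m y by (simp_all add: M_def Y_def)
    have dMY: "d = Y\<^sup>2 - M\<^sup>2" by (simp add: d_def M_def Y_def)
    let ?g = "\<lambda>t. A / d * (of_real t * of_real t powr (s - 1) / of_real (t\<^sup>2 + m\<^sup>2) - of_real t * of_real t powr (s - 1) / of_real (t\<^sup>2 + y\<^sup>2))
      - B / M / d * (Y\<^sup>2 * (of_real t powr (s - 1) / of_real (t\<^sup>2 + y\<^sup>2)) - M\<^sup>2 * (of_real t powr (s - 1) / of_real (t\<^sup>2 + m\<^sup>2)))"
    have fg: "?f t = ?g t" if "t > 0" for t
    proof -
      define a b where "a = complex_of_real (t\<^sup>2 + m\<^sup>2)" and "b = complex_of_real (t\<^sup>2 + y\<^sup>2)"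
      have "t\<^sup>2 + m\<^sup>2 > 0" "t\<^sup>2 + y\<^sup>2 > 0" using that by (simp_all add: add_pos_nonneg)
      then have ab: "a \<noteq> 0" "b \<noteq> 0" unfolding a_def b_def of_real_eq_0_iff by linarith+
      have "d = b - a" "Y\<^sup>2 = b - (of_real t)\<^sup>2" "M\<^sup>2 = a - (of_real t)\<^sup>2"
        by (simp_all add: a_def b_def d_def Y_def M_def)
      moreover from this have ba: "b - a \<noteq> 0" using d by simp
      ultimately show ?thesis
        using two_square_partial_fractions[OF ab ba M(1), of "of_real t powr (s - 1)" "of_real t" A B]
        by (simp only: theta_term_def m_def [symmetric] A_def B_def M_def a_def [symmetric] b_def [symmetric] of_real_power)
    qed
    note I = squares_integrals[OF m] squares_integrals[OF y]
    have gi: "integrable lpos ?g"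
      by (intro Bochner_Integration.integrable_diff integrable_mult_right I)
    have "integral\<^sup>L lpos ?g = A / d * (v * (M * M powr (s - 2)) - v * (Y * Y powr (s - 2)))
       - B / M / d * (Y\<^sup>2 * (u * Y powr (s - 2)) - M\<^sup>2 * (u * M powr (s - 2)))"
      by (subst Bochner_Integration.integral_diff | intro Bochner_Integration.integrable_diff integrable_mult_right I |
          simp only: integral_mult_right_zero I M_def [symmetric] Y_def [symmetric])+
    also have "\<dots> = M * M powr (s - 2) * (v * A + u * B) / d - Y powr (s - 2) * (v * (Y * A / d) + u * (Y\<^sup>2 * B / M / d))"
      using M d by (simp add: divide_simps) (simp add: power2_eq_square algebra_simps)
    also have "M * M powr (s - 2) = M powr (s - 1)"
      using M by (simp add: powr_diff power2_eq_square)
    also have "M powr (s - 1) * (v * A + u * B) / d = stieltjes_term y n"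
      by (simp only: stieltjes_term_def M_def m_def A_def B_def d_def)
    \<comment> \<open>The odd part of \<open>pf_term\<close> in its argument carries
      \<open>gauss_cos\<close>, the even part \<open>gauss_sin\<close>.\<close>
    also have "Y * A / d = (pf_term Y n - pf_term (- Y) n) / 4"
      unfolding pf_term_def m_def [symmetric] M_def [symmetric] A_def [symmetric] B_def [symmetric] power2_minus dMY [symmetric]
      by (simp add: diff_divide_distrib [symmetric])
    also have "Y\<^sup>2 * B / M / d = (pf_term Y n + pf_term (- Y) n) / (4 * \<i>)"
      unfolding pf_term_def m_def [symmetric] M_def [symmetric] A_def [symmetric] B_def [symmetric] power2_minus dMY [symmetric]
      by (simp add: add_divide_distrib [symmetric]) (simp add: mult_ac)
    finally have gv: "integral\<^sup>L lpos ?g = ?R" by (simp only: Y_def)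
    have "integrable lpos ?f = integrable lpos ?g" by (rule integrable_lpos_cong) (rule fg)
    moreover have "integral\<^sup>L lpos ?f = integral\<^sup>L lpos ?g" by (rule integral_lpos_cong) (rule fg)
    ultimately show ?thesis using gi gv by (simp only:)
  qed
  then show "integrable lpos ?f" "integral\<^sup>L lpos ?f = ?R" by auto
qed

lemma integrable_stieltjes:
  assumes y: "y > 0"
  shows "integrable lpos (\<lambda>t. of_real t powr (s - 1) * theta t / of_real (t\<^sup>2 + y\<^sup>2))"
proof (rule Bochner_Integration.integrable_bound)
  show "integrable lpos (\<lambda>t. of_real chi_norm * (of_real t powr (s - 1) / of_real (t\<^sup>2 + y\<^sup>2)) :: complex)"
    by (intro integrable_mult_right squares_integrals y)
  show "(\<lambda>t. of_real t powr (s - 1) * theta t / of_real (t\<^sup>2 + y\<^sup>2)) \<in> borel_measurable lpos"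
    by (rule measurable_lpos) measurable
  show "AE t in lpos. norm (of_real t powr (s - 1) * theta t / of_real (t\<^sup>2 + y\<^sup>2)) \<le>
     norm (of_real chi_norm * (of_real t powr (s - 1) / of_real (t\<^sup>2 + y\<^sup>2)) :: complex)"
  proof (rule AE_lpos)
    fix t :: real assume t: "t > 0"
    have "exp (- (2 / real q) * t) \<le> 1" using t by simp
    then have "chi_norm * exp (- (2 / real q) * t) \<le> chi_norm"
      using chi_norm_nonneg by (intro mult_left_le) auto
    then have "norm (theta t) \<le> chi_norm" using norm_theta_le[OF t] by linarith
    then show "norm (of_real t powr (s - 1) * theta t / of_real (t\<^sup>2 + y\<^sup>2)) \<le>
     norm (of_real chi_norm * (of_real t powr (s - 1) / of_real (t\<^sup>2 + y\<^sup>2)) :: complex)"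
      using chi_norm_nonneg unfolding norm_mult norm_divide
      by (simp add: mult.commute) (intro divide_right_mono mult_right_mono; simp)
  qed
qed

text \<open>Sum \<open>integral_theta_term\<close> over \<open>n\<close>. The integrals add up to
  \<open>stieltjes s y\<close> apart from the constant \<open>P0\<close>, and the
  \<open>pf_term\<close> part adds up to values of \<open>char_csc\<close> at y and -y, that is, to
  the cosine and sine sums.\<close>

lemma stieltjes_term_sums:
  assumes y: "y > 0" and siny: "sin y \<noteq> 0"
  shows "stieltjes_term y sums (stieltjes s y + of_real y powr (s - 2) *
    (v * (\<Sum>l=1..q-1. chi (int l) * of_real (cos ((2 * real l / real q - 1) * y))) +
     u * (\<Sum>l=1..q-1. chi (int l) * of_real (sin ((2 * real l / real q - 1) * y)))) / (2 * of_real (sin y)))"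
proof -
  obtain P0 where P0: "\<And>z. sin z \<noteq> 0 \<Longrightarrow> pf_term z sums (char_csc z - P0)"
    using partial_fractions by blast
  define Y where "Y = complex_of_real y"
  have ne: "y \<noteq> pi * real n" for n
  proof
    assume "y = pi * real n"
    then have "sin y = 0" using sin_zero_iff_int2[of y] by (metis mult.commute of_int_of_nat_eq)
    then show False using siny by simp
  qed
  let ?f = "\<lambda>n t. complex_of_real t powr (s - 1) * theta_term n t / of_real (t\<^sup>2 + y\<^sup>2)"
  \<comment> \<open>Dominating function for the interchange; its factor \<open>t\<close> comes from
    \<open>norm_theta_term_le\<close>.\<close>
  define h where "h t = norm (complex_of_real t * of_real t powr (s - 1) / of_real (t\<^sup>2 + y\<^sup>2))" for t
  have h: "integrable lpos h" unfolding h_def by (intro integrable_norm squares_integrals y)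
  have fle: "norm (?f n t) \<le> 2 * chi_norm * (1 / (real n)\<^sup>2) * h t" if t: "t > 0" for n t
  proof -
    have "norm (?f n t) = norm (complex_of_real t powr (s - 1)) / norm (complex_of_real (t\<^sup>2 + y\<^sup>2)) * norm (theta_term n t)"
      by (simp only: norm_mult norm_divide) simp
    also have "\<dots> \<le> norm (complex_of_real t powr (s - 1)) / norm (complex_of_real (t\<^sup>2 + y\<^sup>2)) * (2 * chi_norm / (real n)\<^sup>2 * t)"
      by (intro mult_left_mono norm_theta_term_le t) auto
    also have "\<dots> = 2 * chi_norm * (1 / (real n)\<^sup>2) * h t"
      using t unfolding h_def norm_mult norm_divide by (simp add: mult_ac)
    finally show ?thesis .
  qed
  have inv2: "summable (\<lambda>n. 1 / (real n)\<^sup>2)"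
    using inverse_power_summable[of 2, where 'a=real] by (simp add: field_simps)
  have bound_summable: "summable (\<lambda>n. 2 * chi_norm * (1 / (real n)\<^sup>2) * c)" for c
    by (intro summable_mult2 summable_mult inv2)
  have fsums: "(\<lambda>n. ?f n t) sums (of_real t powr (s - 1) * (theta t - \<i> / 2 * P0) / of_real (t\<^sup>2 + y\<^sup>2))" if t: "t > 0" for t
  proof -
    have "(\<lambda>n. \<i> / 2 * pf_term (\<i> * of_real t) n) sums (\<i> / 2 * (char_csc (\<i> * of_real t) - P0))"
      using theta_conv_char_csc(2)[OF t] by (intro sums_mult P0)
    then have "(\<lambda>n. theta_term n t) sums (theta t - \<i> / 2 * P0)"
      unfolding theta_term_conv_pf_term theta_conv_char_csc(1)[OF t] by (simp add: right_diff_distrib)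
    then show ?thesis by (intro sums_divide sums_mult)
  qed
  have "(\<lambda>n. integral\<^sup>L lpos (?f n)) sums (\<integral>t. (\<Sum>n. ?f n t) \<partial>lpos)"
  proof (rule sums_integral)
    show "integrable lpos (?f n)" for n by (rule integral_theta_term[OF y ne])
    show "AE t in lpos. summable (\<lambda>n. norm (?f n t))"
    proof (rule AE_lpos)
      fix t :: real assume t: "t > 0"
      show "summable (\<lambda>n. norm (?f n t))"
        by (rule summable_comparison_test'[OF bound_summable[of "h t"], of 0]) (simp only: real_norm_def abs_norm_cancel fle[OF t])
    qed
    have nf: "(\<integral>t. norm (?f n t) \<partial>lpos) \<le> 2 * chi_norm * (1 / (real n)\<^sup>2) * integral\<^sup>L lpos h" for n
    proof -
      have "(\<integral>t. norm (?f n t) \<partial>lpos) \<le> (\<integral>t. 2 * chi_norm * (1 / (real n)\<^sup>2) * h t \<partial>lpos)"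
        by (intro integral_mono_AE integrable_norm integral_theta_term[OF y ne] integrable_mult_right h AE_lpos fle)
      also have "\<dots> = 2 * chi_norm * (1 / (real n)\<^sup>2) * integral\<^sup>L lpos h" by (rule integral_mult_right_zero)
      finally show ?thesis .
    qed
    show "summable (\<lambda>n. \<integral>t. norm (?f n t) \<partial>lpos)"
    proof (rule summable_comparison_test'[OF bound_summable[of "integral\<^sup>L lpos h"], of 0])
      fix n
      have "(\<integral>t. norm (?f n t) \<partial>lpos) \<ge> 0" by (rule integral_nonneg_AE) simp
      then show "norm (\<integral>t. norm (?f n t) \<partial>lpos) \<le> 2 * chi_norm * (1 / (real n)\<^sup>2) * integral\<^sup>L lpos h"
        using nf[of n] by (simp only: real_norm_def abs_of_nonneg)
    qed
  qed
  also have "(\<integral>t. (\<Sum>n. ?f n t) \<partial>lpos) = (\<integral>t. of_real t powr (s - 1) * theta t / of_real (t\<^sup>2 + y\<^sup>2) -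
      \<i> / 2 * P0 * (of_real t powr (s - 1) / of_real (t\<^sup>2 + y\<^sup>2)) \<partial>lpos)"
    by (intro integral_lpos_cong, subst sums_unique[OF fsums, symmetric])
       (auto simp: right_diff_distrib diff_divide_distrib)
  also have "\<dots> = stieltjes s y - \<i> / 2 * P0 * (u * Y powr (s - 2))"
    unfolding stieltjes_def Y_def
    by (subst Bochner_Integration.integral_diff)
       (intro integrable_stieltjes integrable_mult_right squares_integrals y |
        simp only: integral_mult_right_zero squares_integrals[OF y])+
  finally have S1: "(\<lambda>n. integral\<^sup>L lpos (?f n)) sums (stieltjes s y - \<i> / 2 * P0 * (u * Y powr (s - 2)))" .
  have sY: "sin Y = of_real (sin y)" by (simp add: Y_def sin_of_real)
  have sY0: "sin Y \<noteq> 0" "sin (- Y) \<noteq> 0" using siny by (simp_all add: sY)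
  have S2: "(\<lambda>n. Y powr (s - 2) * (v * ((pf_term Y n - pf_term (- Y) n) / 4) + u * ((pf_term Y n + pf_term (- Y) n) / (4 * \<i>)))) sums
     (Y powr (s - 2) * (v * ((char_csc Y - P0 - (char_csc (- Y) - P0)) / 4) + u * ((char_csc Y - P0 + (char_csc (- Y) - P0)) / (4 * \<i>))))"
    by (intro sums_mult sums_add sums_divide sums_diff P0 sY0)
  have S12: "integral\<^sup>L lpos (?f n) + Y powr (s - 2) * (v * ((pf_term Y n - pf_term (- Y) n) / 4) + u * ((pf_term Y n + pf_term (- Y) n) / (4 * \<i>)))
     = stieltjes_term y n" for n
    unfolding integral_theta_term(2)[OF y ne] Y_def by simp
  define Cc where "Cc = (\<Sum>l=1..q-1. chi (int l) * of_real (cos ((2 * real l / real q - 1) * y)))"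
  define Ss where "Ss = (\<Sum>l=1..q-1. chi (int l) * of_real (sin ((2 * real l / real q - 1) * y)))"
  have e1: "exp (\<i> * of_real (2 * real l / real q - 1) * Y) = of_real (cos ((2 * real l / real q - 1) * y)) + \<i> * of_real (sin ((2 * real l / real q - 1) * y))" for l :: nat
  proof -
    have "\<i> * of_real (2 * real l / real q - 1) * Y = \<i> * of_real ((2 * real l / real q - 1) * y)"
      by (simp only: Y_def of_real_mult mult.assoc)
    then show ?thesis by (simp only: exp_Euler cos_of_real sin_of_real)
  qed
  have e2: "exp (\<i> * of_real (2 * real l / real q - 1) * - Y) = of_real (cos ((2 * real l / real q - 1) * y)) - \<i> * of_real (sin ((2 * real l / real q - 1) * y))" for l :: nat
  proof -
    have "\<i> * of_real (2 * real l / real q - 1) * - Y = \<i> * of_real (- ((2 * real l / real q - 1) * y))"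
      by (simp only: Y_def of_real_mult of_real_minus mult.assoc mult_minus_right)
    then show ?thesis by (simp only: exp_Euler cos_of_real sin_of_real cos_minus sin_minus) simp
  qed
  have c1: "char_csc Y = (Cc + \<i> * Ss) / of_real (sin y)"
    unfolding char_csc_def e1 sY Cc_def Ss_def sum_distrib_left sum.distrib [symmetric]
    by (simp add: algebra_simps)
  have c2: "char_csc (- Y) = - (Cc - \<i> * Ss) / of_real (sin y)"
    unfolding char_csc_def e2 sin_minus sY Cc_def Ss_def sum_distrib_left sum_subtractf [symmetric]
    by (simp add: algebra_simps)
  \<comment> \<open>The constant \<open>P0\<close> cancels here: it drops out of the difference of
    the two \<open>char_csc\<close> values, and in their sum it offsets the contribution from
    theta.\<close>
  have fin: "stieltjes s y - \<i> / 2 * P0 * (u * Y powr (s - 2)) +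
      Y powr (s - 2) * (v * ((char_csc Y - P0 - (char_csc (- Y) - P0)) / 4) + u * ((char_csc Y - P0 + (char_csc (- Y) - P0)) / (4 * \<i>))) =
     stieltjes s y + Y powr (s - 2) * (v * Cc + u * Ss) / (2 * of_real (sin y))"
  proof -
    have a: "(char_csc Y - P0 - (char_csc (- Y) - P0)) / 4 = Cc / (2 * of_real (sin y))"
      unfolding c1 c2 by (simp add: diff_divide_distrib [symmetric])
    have b: "(char_csc Y - P0 + (char_csc (- Y) - P0)) / (4 * \<i>) = Ss / (2 * of_real (sin y)) + \<i> / 2 * P0"
      unfolding c1 c2 using siny by (simp add: field_simps)
    show ?thesis unfolding a b by (simp add: algebra_simps add_divide_distrib)
  qed
  show ?thesis
    using sums_add[OF S1 S2] unfolding S12 fin unfolding Cc_def Ss_def Y_def .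
qed

text \<open>Multiplying \<open>stieltjes_term_sums\<close> by the prefactor of
  \<open>gamma_fun\<close> turns the trigonometric part into exactly \<open>varphi\<close>, because
  sin(pi s) = 2 S C cancels the denominators and y^s = y^2 y^(s-2). Only the integral is left in the
  difference.\<close>

lemma varphi_minus_gamma_eq:
  assumes y: "y > 0" and siny: "sin y \<noteq> 0"
  shows "varphi q chi s y - gamma_fun q chi s y = 2 powr s * of_real (y\<^sup>2) * of_real (sin y) * stieltjes s y"
proof -
  define Cc where "Cc = (\<Sum>l=1..q-1. chi (int l) * of_real (cos ((2 * real l / real q - 1) * y)))"
  define Ss where "Ss = (\<Sum>l=1..q-1. chi (int l) * of_real (sin ((2 * real l / real q - 1) * y)))"
  define S C where "S = sin (of_real pi * s / 2)" and "C = cos (of_real pi * s / 2)"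
  have SC: "S \<noteq> 0" "C \<noteq> 0" unfolding S_def C_def using sin_cos_half_nonzero[OF s] by auto
  have sinpi: "sin (of_real pi * s) = 2 * S * C"
    using sin_double[of "of_real pi * s / 2"] by (simp add: S_def C_def)
  have uv: "u = of_real pi / (2 * S)" "v = of_real pi / (2 * C)"
    by (simp_all add: u_def v_def S_def C_def)
  have ne: "y \<noteq> pi * real n" for n
  proof
    assume "y = pi * real n"
    then have "sin y = 0" using sin_zero_iff_int2[of y] by (metis mult.commute of_int_of_nat_eq)
    then show False using siny by simp
  qed
  have T: "of_real (pi * real n) powr (s - 1) * gamma_coeff s n * of_real (sin_quotient n y) =
      of_real (sin y) * (2 * S * C / of_real pi) * stieltjes_term y n" for n
  proof -
    have "0 \<le> pi * real n" by simp
    then have "y \<noteq> - (pi * real n)" using y by linarith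
    then have "y\<^sup>2 \<noteq> (pi * real n)\<^sup>2" using ne[of n] by (simp add: power2_eq_iff)
    then have "sin_quotient n y = sin y / (y\<^sup>2 - (pi * real n)\<^sup>2)" by (simp add: sin_quotient_def)
    moreover have "gamma_coeff s n = (2 * S * C / of_real pi) * (v * gauss_cos n + u * gauss_sin n)"
      unfolding gamma_coeff_def S_def [symmetric] C_def [symmetric] uv using SC by (simp add: field_simps)
    ultimately show ?thesis unfolding stieltjes_term_def by simp
  qed
  have y0: "complex_of_real y \<noteq> 0" "complex_of_real (sin y) \<noteq> 0" using y siny by auto
  define W where "W = complex_of_real y powr (s - 2)"
  have ys: "complex_of_real y powr s = of_real (y\<^sup>2) * W"
    using y by (simp add: W_def powr_diff power2_eq_square)
  have two: "(2::complex) powr (s - 2) = 2 powr s / 4" by (simp add: powr_diff)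
  have "(\<Sum>n. of_real (pi * real n) powr (s - 1) * gamma_coeff s n * of_real (sin_quotient n y)) =
      of_real (sin y) * (2 * S * C / of_real pi) * (stieltjes s y + W * (v * Cc + u * Ss) / (2 * of_real (sin y)))"
    unfolding T using stieltjes_term_sums[OF y siny] unfolding Cc_def [symmetric] Ss_def [symmetric] W_def [symmetric]
    by (intro sums_unique[symmetric] sums_mult)
  then have "gamma_fun q chi s y = - (of_real pi * 2 powr s * of_real (y\<^sup>2) / (2 * S * C)) *
     (of_real (sin y) * (2 * S * C / of_real pi) * (stieltjes s y + W * (v * Cc + u * Ss) / (2 * of_real (sin y))))"
    using gamma_fun_eq_suminf[of s y] s by (simp only: sinpi)
  also have "\<dots> = - (2 powr s * of_real (y\<^sup>2) * of_real (sin y) * stieltjes s y) - 2 powr s * of_real (y\<^sup>2) * W * (v * Cc + u * Ss) / 2"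
    using SC y0 by (simp add: divide_simps) (simp add: algebra_simps)
  finally have g: "gamma_fun q chi s y = \<dots>" .
  have "varphi q chi s y = - of_real pi * (2 powr s / 4) * (of_real (y\<^sup>2) * W * Ss / S + of_real (y\<^sup>2) * W * Cc / C)"
    using y unfolding varphi_def Cc_def [symmetric] Ss_def [symmetric] S_def [symmetric] C_def [symmetric] two ys [symmetric] by simp
  also have "\<dots> = - (2 powr s) * of_real (y\<^sup>2) * W * (v * Cc + u * Ss) / 2"
    unfolding uv using SC by (simp add: field_simps)
  finally show ?thesis unfolding g by simp
qed

end

end

section \<open>Integrability\<close>

text \<open>The formula for the difference holds off the zeros of the sine, which is enough for both
  integral estimates.\<close>

lemma AE_sin_nonzero: "AE y in lebesgue. sin (y::real) \<noteq> 0"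
proof (rule AE_I')
  have "countable (range (\<lambda>n::int. of_int n * pi))" by simp
  then have "range (\<lambda>n::int. of_int n * pi) \<in> null_sets lborel" by (rule countable_imp_null_set_lborel)
  then show "range (\<lambda>n::int. of_int n * pi) \<in> null_sets lebesgue" by (rule null_sets_completionI)
  show "{y \<in> space lebesgue. \<not> sin y \<noteq> 0} \<subseteq> range (\<lambda>n::int. of_int n * pi)"
    by (auto simp: sin_zero_iff_int2)
qed

text \<open>Comparison with 1 on [-1, 1] and with |y|^(-2p) outside; the assumption on
  \<open>p\<close> says 2p > 1, which makes the tails converge.\<close>

lemma nn_integral_inverse_square_powr_finite:
  assumes "p > 1/2" "K \<ge> 0"
  shows "(\<integral>\<^sup>+ y. ennreal ((K / (1 + y\<^sup>2)) powr p) \<partial>lebesgue) < \<infinity>"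
proof -
  define g where "g y = indicator {-1..1::real} y + \<bar>y\<bar> powr (- 2 * p) * indicator {1..} \<bar>y\<bar>" for y :: real
  have tail: "integrable lborel (\<lambda>y. y powr (- 2 * p) * indicator {1..} y :: real)"
  proof -
    have "((\<lambda>y. y powr (- 2 * p)) has_integral - (1 powr (- 2 * p + 1)) / (- 2 * p + 1)) {1..}"
      using assms by (intro has_integral_powr_to_inf) auto
    then have "(\<lambda>y. y powr (- 2 * p)) absolutely_integrable_on {1..}"
      by (intro nonnegative_absolutely_integrable_1) (auto simp: has_integral_integrable)
    then have "set_integrable lborel {1..} (\<lambda>y. y powr (- 2 * p))"
      unfolding set_integrable_def by (subst (asm) integrable_completion) auto
    then show ?thesis by (simp add: set_integrable_def mult.commute)
  qed
  have tail2: "integrable lborel (\<lambda>y. (- y) powr (- 2 * p) * indicator {1..} (- y) :: real)"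
    using lborel_integrable_real_affine[OF tail, of "-1" 0] by simp
  have "integrable lborel (\<lambda>y. indicator {-1..1} y + (y powr (- 2 * p) * indicator {1..} y + (- y) powr (- 2 * p) * indicator {1..} (- y)) :: real)"
    by (intro Bochner_Integration.integrable_add tail tail2) simp
  moreover have "indicator {-1..1} y + (y powr (- 2 * p) * indicator {1..} y + (- y) powr (- 2 * p) * indicator {1..} (- y)) = g y" for y
    by (auto simp: g_def indicator_def)
  ultimately have gi: "integrable lborel g" by simp
  have "(K / (1 + y\<^sup>2)) powr p \<le> K powr p * g y" for y
  proof -
    have "\<bar>y\<bar> > 1 \<Longrightarrow> (1 / (1 + y\<^sup>2)) powr p \<le> \<bar>y\<bar> powr (- 2 * p)"
    proof -
      assume y: "\<bar>y\<bar> > 1"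
      have "1 / (1 + y\<^sup>2) \<le> 1 / \<bar>y\<bar>\<^sup>2" using y by (intro divide_left_mono mult_pos_pos add_pos_nonneg) auto
      also have "1 / \<bar>y\<bar>\<^sup>2 = \<bar>y\<bar> powr (- 2)" using y by (simp add: powr_minus powr_numeral divide_inverse)
      finally have "(1 / (1 + y\<^sup>2)) powr p \<le> (\<bar>y\<bar> powr (- 2)) powr p"
        using assms by (intro powr_mono2) auto
      then show ?thesis by (simp add: powr_powr)
    qed
    moreover have "(1 / (1 + y\<^sup>2)) powr p \<le> 1"
    proof (intro powr_le1)
      have "1 / (1 + y\<^sup>2) \<le> 1 / 1" by (intro divide_left_mono) (auto simp: add_pos_nonneg)
      moreover have "0 \<le> 1 / (1 + y\<^sup>2)" by simp
      ultimately show "\<bar>1 / (1 + y\<^sup>2)\<bar> \<le> 1" by linarith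
    qed (use assms in auto)
    ultimately have 1: "(1 / (1 + y\<^sup>2)) powr p \<le> g y"
      by (auto simp: g_def indicator_def abs_le_iff intro: add_increasing2)
    have "(K / (1 + y\<^sup>2)) powr p = (K * (1 / (1 + y\<^sup>2))) powr p" by simp
    also have "\<dots> = K powr p * (1 / (1 + y\<^sup>2)) powr p"
      by (rule powr_mult)
    also have "\<dots> \<le> K powr p * g y" using 1 by (intro mult_left_mono) auto
    finally show ?thesis .
  qed
  then have "(\<integral>\<^sup>+ y. ennreal ((K / (1 + y\<^sup>2)) powr p) \<partial>lebesgue) \<le> (\<integral>\<^sup>+ y. ennreal (K powr p * g y) \<partial>lebesgue)"
    by (intro nn_integral_mono ennreal_leI)
  also have "\<dots> = (\<integral>\<^sup>+ y. ennreal (K powr p * g y) \<partial>lborel)"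
    by (rule nn_integral_completion)
  also have "\<dots> < \<infinity>"
  proof -
    have "integrable lborel (\<lambda>y. K powr p * g y)" using gi by simp
    then show ?thesis using integrableD(2) by (metis infinity_ennreal_def top.not_eq_extremum)
  qed
  finally show ?thesis .
qed

text \<open>
  Were the integral finite, so would be that of \<open>|cos|\<^bsup>p\<^esup>\<close> by translation, but
  \<open>|sin|\<^bsup>p\<^esup> + |cos|\<^bsup>p\<^esup>\<close> is bounded below.
\<close>

lemma nn_integral_sin_powr_infinite:
  fixes p Y :: real
  assumes p: "p > 0"
  shows "(\<integral>\<^sup>+ y. ennreal (\<bar>sin y\<bar> powr p) * indicator {Y..} y \<partial>lborel) = \<infinity>"
proof (rule ccontr)
  let ?s = "\<lambda>y. ennreal (\<bar>sin y\<bar> powr p) * indicator {Y..} y"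
  let ?c = "\<lambda>y. ennreal (\<bar>cos y\<bar> powr p) * indicator {Y..} y"
  assume fin: "(\<integral>\<^sup>+ y. ?s y \<partial>lborel) \<noteq> \<infinity>"
  have "(\<integral>\<^sup>+ y. ?s y \<partial>lborel) = (\<integral>\<^sup>+ y. ?s (pi / 2 + 1 * y) \<partial>lborel)"
    using nn_integral_real_affine[of ?s 1 "pi / 2"] by simp
  moreover have "?c y \<le> ?s (pi / 2 + 1 * y)" for y
  proof (cases "Y \<le> y")
    case True
    then have "Y \<le> pi / 2 + 1 * y" using pi_half_gt_zero by linarith
    then show ?thesis using True by (simp add: sin_add)
  qed simp
  ultimately have cle: "(\<integral>\<^sup>+ y. ?c y \<partial>lborel) \<le> (\<integral>\<^sup>+ y. ?s y \<partial>lborel)"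
    by (simp only:) (rule nn_integral_mono)
  have "(1/2) powr p \<le> \<bar>sin y\<bar> powr p + \<bar>cos y\<bar> powr p" for y :: real
  proof -
    have "1/2 \<le> \<bar>sin y\<bar> \<or> 1/2 \<le> \<bar>cos y\<bar>"
    proof (rule ccontr)
      assume "\<not> ?thesis"
      then have "\<bar>sin y\<bar> < 1/2" "\<bar>cos y\<bar> < 1/2" by auto
      then have "\<bar>sin y\<bar>\<^sup>2 < (1/2)\<^sup>2" "\<bar>cos y\<bar>\<^sup>2 < (1/2)\<^sup>2"
        by (intro power_strict_mono; simp)+
      then have "(sin y)\<^sup>2 + (cos y)\<^sup>2 < 1" by (simp add: power2_eq_square)
      then show False by simp
    qed
    then show ?thesis
      using p powr_mono2[of p "1/2" "\<bar>sin y\<bar>"] powr_mono2[of p "1/2" "\<bar>cos y\<bar>"]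
      by (auto intro: add_increasing add_increasing2)
  qed
  then have "ennreal ((1/2) powr p) * indicator {Y..} y \<le> ?s y + ?c y" for y
    by (auto simp: indicator_def simp flip: ennreal_plus intro!: ennreal_leI)
  then have "(\<integral>\<^sup>+ y. ennreal ((1/2) powr p) * indicator {Y..} y \<partial>lborel) \<le> (\<integral>\<^sup>+ y. ?s y + ?c y \<partial>lborel)"
    by (rule nn_integral_mono)
  also have "\<dots> = (\<integral>\<^sup>+ y. ?s y \<partial>lborel) + (\<integral>\<^sup>+ y. ?c y \<partial>lborel)"
    by (rule nn_integral_add) auto
  also have "\<dots> < \<infinity>" using fin cle by (auto simp: ennreal_add_eq_top less_top top_unique)
  also have "(\<integral>\<^sup>+ y. ennreal ((1/2) powr p) * indicator {Y..} y \<partial>lborel) = ennreal ((1/2) powr p) * emeasure lborel {Y..}"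
    by (rule nn_integral_cmult_indicator) simp
  also have "emeasure lborel {Y..} = \<infinity>"
  proof -
    have "emeasure lborel {Y..} \<ge> of_nat n" for n
    proof -
      have "emeasure lborel {Y..Y + real n} \<le> emeasure lborel {Y..}"
        by (intro emeasure_mono) auto
      then show ?thesis by (simp add: ennreal_of_nat_eq_real_of_nat)
    qed
    then show ?thesis by (metis ennreal_Ex_less_of_nat infinity_ennreal_def less_le_not_le top.not_eq_extremum)
  qed
  finally show False by (simp add: ennreal_mult_top)
qed

section \<open>Oddness and measurability of the two functions\<close>

lemma sin_quotient_minus: "sin_quotient n (- y) = - sin_quotient n y"
  by (simp add: sin_quotient_def)

context nonprincipal_character
begin

lemma varphi_minus: "varphi q chi s (- y) = - varphi q chi s y"
  by (simp only: varphi_def mult_minus_right sin_minus cos_minus of_real_minus sum_negf abs_minus_cancel sgn_minus)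
     (simp add: algebra_simps)

lemma gamma_fun_minus: "gamma_fun q chi s (- y) = - gamma_fun q chi s y"
  unfolding gamma_fun_def sin_quotient_minus of_real_minus mult_minus_right infsum_uminus by simp

lemma borel_measurable_varphi: "varphi q chi s \<in> borel_measurable borel"
proof -
  have [measurable]: "(\<lambda>y. complex_of_real \<bar>y\<bar> powr s) \<in> borel_measurable borel"
    by (rule measurable_compose[OF _ borel_measurable_of_real_powr]) measurable
  have [measurable]: "(\<lambda>y::real. sgn y) \<in> borel_measurable borel"
    unfolding sgn_if by measurable
  show ?thesis unfolding varphi_def by measurable
qed

lemma borel_measurable_gamma_fun:
  assumes "Re s < 1"
  shows "gamma_fun q chi s \<in> borel_measurable borel"
proof -
  have [measurable]: "sin_quotient n \<in> borel_measurable borel" for n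
    unfolding sin_quotient_def by measurable
  show ?thesis unfolding gamma_fun_eq_suminf[OF assms, abs_def] by measurable
qed

text \<open>The factor y^2 / (t^2 + y^2) is at most 1, and differs from 1 by at most t^2 / y^2. So
  \<open>C1\<close> is the absolute Mellin integral at \<open>s\<close> and \<open>C2\<close> the
  one at \<open>s + 2\<close>, both finite by the decay of theta.\<close>

lemma stieltjes_decay:
  assumes s: "0 < Re s" "Re s < 1"
  obtains C1 C2 where "C1 \<ge> 0" "C2 \<ge> 0"
    "\<And>y. y > 0 \<Longrightarrow> norm (of_real (y\<^sup>2) * stieltjes s y) \<le> C1"
    "\<And>y. y > 0 \<Longrightarrow> norm (of_real (y\<^sup>2) * stieltjes s y - mellin s) \<le> C2 / y\<^sup>2"
proof -
  define m where "m t = complex_of_real t powr (s - 1) * theta t" for t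
  define m2 where "m2 t = complex_of_real t powr (s + 2 - 1) * theta t" for t
  have im: "integrable lpos m" unfolding m_def using s by (intro integrable_mellin)
  have im2: "integrable lpos m2" unfolding m2_def using s by (intro integrable_mellin) auto
  have m2: "m2 t = of_real (t\<^sup>2) * m t" if "t > 0" for t
  proof -
    have "complex_of_real t powr (s + 2 - 1) = complex_of_real t powr (s - 1 + 2)"
      by (rule arg_cong) simp
    also have "\<dots> = of_real t powr (s - 1) * of_real t powr 2" by (rule powr_add)
    also have "complex_of_real t powr 2 = of_real (t\<^sup>2)"
      using of_real_square_powr[OF that, of 1] by simp
    finally show ?thesis by (simp add: m_def m2_def)
  qed
  define C1 where "C1 = (\<integral>t. norm (m t) \<partial>lpos)"
  define C2 where "C2 = (\<integral>t. norm (m2 t) \<partial>lpos)"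
  have St: "of_real (y\<^sup>2) * stieltjes s y = (\<integral>t. of_real (y\<^sup>2) * (m t / of_real (t\<^sup>2 + y\<^sup>2)) \<partial>lpos)" for y
    unfolding stieltjes_def m_def by (rule integral_mult_right_zero [symmetric])
  have Si: "integrable lpos (\<lambda>t. of_real (y\<^sup>2) * (m t / of_real (t\<^sup>2 + y\<^sup>2)))" if "y > 0" for y
    unfolding m_def by (intro integrable_mult_right integrable_stieltjes s that)
  have b1: "norm (of_real (y\<^sup>2) * stieltjes s y) \<le> C1" if y: "y > 0" for y
  proof -
    have "norm (of_real (y\<^sup>2) * stieltjes s y) \<le> (\<integral>t. norm (of_real (y\<^sup>2) * (m t / of_real (t\<^sup>2 + y\<^sup>2))) \<partial>lpos)"
      unfolding St by (rule integral_norm_bound)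
    also have "\<dots> \<le> C1"
      unfolding C1_def
    proof (intro integral_mono_AE integrable_norm Si y im AE_lpos)
      fix t :: real assume t: "t > 0"
      have d: "t\<^sup>2 + y\<^sup>2 > 0" using y by (simp add: add_nonneg_pos)
      have "norm (of_real (y\<^sup>2) * (m t / of_real (t\<^sup>2 + y\<^sup>2))) = y\<^sup>2 / (t\<^sup>2 + y\<^sup>2) * norm (m t)"
        using d unfolding norm_mult norm_divide norm_of_real by simp
      also have "\<dots> \<le> 1 * norm (m t)" using d by (intro mult_right_mono) auto
      finally show "norm (of_real (y\<^sup>2) * (m t / of_real (t\<^sup>2 + y\<^sup>2))) \<le> norm (m t)" by simp
    qed
    finally show ?thesis .
  qed
  have b2: "norm (of_real (y\<^sup>2) * stieltjes s y - mellin s) \<le> C2 / y\<^sup>2" if y: "y > 0" for y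
  proof -
    have "of_real (y\<^sup>2) * stieltjes s y - mellin s = (\<integral>t. of_real (y\<^sup>2) * (m t / of_real (t\<^sup>2 + y\<^sup>2)) - m t \<partial>lpos)"
      unfolding St mellin_def m_def [symmetric] using Bochner_Integration.integral_diff[OF Si[OF y] im] by simp
    also have "norm \<dots> \<le> (\<integral>t. norm (of_real (y\<^sup>2) * (m t / of_real (t\<^sup>2 + y\<^sup>2)) - m t) \<partial>lpos)"
      by (rule integral_norm_bound)
    also have "\<dots> \<le> (\<integral>t. norm (m2 t) / y\<^sup>2 \<partial>lpos)"
    proof (intro integral_mono_AE integrable_norm Bochner_Integration.integrable_diff Si y im im2 integrable_divide AE_lpos)
      fix t :: real assume t: "t > 0"
      have d: "t\<^sup>2 + y\<^sup>2 > 0" using y by (simp add: add_nonneg_pos)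
      then have d': "complex_of_real (t\<^sup>2 + y\<^sup>2) \<noteq> 0" unfolding of_real_eq_0_iff by linarith
      have "of_real (y\<^sup>2) * (m t / of_real (t\<^sup>2 + y\<^sup>2)) - m t = - m2 t / of_real (t\<^sup>2 + y\<^sup>2)"
        unfolding m2[OF t] using d' by (simp add: field_simps)
      then have "norm (of_real (y\<^sup>2) * (m t / of_real (t\<^sup>2 + y\<^sup>2)) - m t) = norm (m2 t) / (t\<^sup>2 + y\<^sup>2)"
        using d by (simp only: norm_divide norm_minus_cancel norm_of_real abs_of_pos)
      also have "\<dots> \<le> norm (m2 t) / y\<^sup>2" using y d by (intro divide_left_mono) auto
      finally show "norm (of_real (y\<^sup>2) * (m t / of_real (t\<^sup>2 + y\<^sup>2)) - m t) \<le> norm (m2 t) / y\<^sup>2" .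
    qed
    also have "\<dots> = C2 / y\<^sup>2" by (simp add: C2_def)
    finally show ?thesis .
  qed
  have "C1 \<ge> 0" "C2 \<ge> 0" by (simp_all add: C1_def C2_def)
  then show ?thesis using b1 b2 by (rule that)
qed

lemma difference_in_L_space:
  assumes s: "0 < Re s" "Re s < 1" and p: "p > 1/2" and L: "mellin s = 0"
  shows "(\<lambda>y. varphi q chi s y - gamma_fun q chi s y) \<in> L_space p"
proof -
  obtain C1 C2 where C: "C1 \<ge> 0" "C2 \<ge> 0"
    "\<And>y. y > 0 \<Longrightarrow> norm (of_real (y\<^sup>2) * stieltjes s y) \<le> C1"
    "\<And>y. y > 0 \<Longrightarrow> norm (of_real (y\<^sup>2) * stieltjes s y - mellin s) \<le> C2 / y\<^sup>2"
    using stieltjes_decay[OF s] by blast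
  define D where "D y = varphi q chi s y - gamma_fun q chi s y" for y
  define K where "K = norm ((2::complex) powr s) * (C1 + C2)"
  have Dm: "D (- y) = - D y" for y by (simp add: D_def varphi_minus gamma_fun_minus)
  have pos: "norm (D y) \<le> K / (1 + y\<^sup>2)" if y: "y > 0" "sin y \<noteq> 0" for y
  proof -
    define N where "N = norm (of_real (y\<^sup>2) * stieltjes s y)"
    have "D y = 2 powr s * of_real (sin y) * (of_real (y\<^sup>2) * stieltjes s y)"
      using varphi_minus_gamma_eq[OF s y] by (simp add: D_def mult_ac)
    then have "norm (D y) = norm ((2::complex) powr s) * \<bar>sin y\<bar> * N"
      unfolding N_def by (simp only: norm_mult norm_of_real)
    also have "\<dots> \<le> norm ((2::complex) powr s) * 1 * N"
      by (intro mult_right_mono mult_left_mono) (auto simp: N_def)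
    finally have 1: "norm (D y) \<le> norm ((2::complex) powr s) * N" by simp
    \<comment> \<open>Since \<open>mellin s\<close> vanishes, the second bound says y^2 N <= C2.
      Adding the two bounds covers small and large \<open>y\<close> at once and explains
      \<open>K\<close>.\<close>
    have "N \<le> C1" "N \<le> C2 / y\<^sup>2" using C(3,4)[OF y(1)] L by (simp_all add: N_def)
    then have "N * (1 + y\<^sup>2) \<le> C1 + C2" using y by (simp add: field_simps)
    then have "norm ((2::complex) powr s) * (N * (1 + y\<^sup>2)) \<le> K"
      unfolding K_def by (intro mult_left_mono) auto
    then have "norm (D y) * (1 + y\<^sup>2) \<le> K"
      using mult_right_mono[OF 1, of "1 + y\<^sup>2"] by (simp add: mult.assoc)
    then show ?thesis by (simp add: pos_le_divide_eq add_pos_nonneg)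
  qed
  have bound: "norm (D y) \<le> K / (1 + y\<^sup>2)" if "sin y \<noteq> 0" for y
  proof -
    consider "y > 0" | "- y > 0" | "y = 0" by linarith
    then show ?thesis
    proof cases
      case 2
      then show ?thesis using pos[of "- y"] that by (simp add: Dm)
    qed (use pos that in auto)
  qed
  have "(\<integral>\<^sup>+ y. ennreal (norm (D y) powr p) \<partial>lebesgue) \<le> (\<integral>\<^sup>+ y. ennreal ((K / (1 + y\<^sup>2)) powr p) \<partial>lebesgue)"
  proof (rule nn_integral_mono_AE)
    show "AE y in lebesgue. ennreal (norm (D y) powr p) \<le> ennreal ((K / (1 + y\<^sup>2)) powr p)"
      using AE_sin_nonzero
    proof eventually_elim
      case (elim y)
      then show ?case using bound p by (intro ennreal_leI powr_mono2) auto
    qed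
  qed
  also have "\<dots> < \<infinity>" using C by (intro nn_integral_inverse_square_powr_finite p) (simp add: K_def)
  finally have "(\<integral>\<^sup>+ y. ennreal (norm (D y) powr p) \<partial>lebesgue) < \<infinity>" .
  moreover have "D \<in> borel_measurable lebesgue"
    unfolding D_def
    using borel_measurable_varphi borel_measurable_gamma_fun[OF s(2)]
    by (intro measurable_completion borel_measurable_diff) auto
  moreover have "D = (\<lambda>y. varphi q chi s y - gamma_fun q chi s y)" by (simp add: D_def fun_eq_iff)
  ultimately show ?thesis by (simp add: L_space_def)
qed

lemma difference_not_in_L_space:
  assumes s: "0 < Re s" "Re s < 1" and p: "p > 0" and L: "mellin s \<noteq> 0"
  shows "(\<lambda>y. varphi q chi s y - gamma_fun q chi s y) \<notin> L_space p"
proof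
  assume mem: "(\<lambda>y. varphi q chi s y - gamma_fun q chi s y) \<in> L_space p"
  obtain C1 C2 where C: "C1 \<ge> 0" "C2 \<ge> 0"
    "\<And>y. y > 0 \<Longrightarrow> norm (of_real (y\<^sup>2) * stieltjes s y) \<le> C1"
    "\<And>y. y > 0 \<Longrightarrow> norm (of_real (y\<^sup>2) * stieltjes s y - mellin s) \<le> C2 / y\<^sup>2"
    using stieltjes_decay[OF s] by blast
  define D where "D y = varphi q chi s y - gamma_fun q chi s y" for y
  define J where "J = norm (mellin s)"
  have J: "J > 0" using L by (simp add: J_def)
  \<comment> \<open>Beyond \<open>Y\<close> the error C2 / y^2 is at most half of \<open>J\<close>;
    the summand 1 ensures y <= y^2.\<close>
  define Y where "Y = 1 + 2 * C2 / J"
  have Y: "Y \<ge> 1" using J C by (simp add: Y_def)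
  define c where "c = norm ((2::complex) powr s) * (J / 2)"
  have c: "c > 0" using J by (simp add: c_def)
  have lower: "c * \<bar>sin y\<bar> \<le> norm (D y)" if y: "y \<ge> Y" "sin y \<noteq> 0" for y
  proof -
    have y0: "y > 0" "y \<ge> 1" using y Y by auto
    define N where "N = norm (of_real (y\<^sup>2) * stieltjes s y)"
    have "D y = 2 powr s * of_real (sin y) * (of_real (y\<^sup>2) * stieltjes s y)"
      using varphi_minus_gamma_eq[OF s y0(1) y(2)] by (simp add: D_def mult_ac)
    then have D: "norm (D y) = norm ((2::complex) powr s) * \<bar>sin y\<bar> * N"
      unfolding N_def by (simp only: norm_mult norm_of_real)
    have "2 * C2 / J \<le> y\<^sup>2"
    proof -
      have "2 * C2 / J \<le> y" using y by (simp add: Y_def)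
      also have "y \<le> y\<^sup>2" using y0 by (simp add: power2_eq_square)
      finally show ?thesis .
    qed
    then have "C2 / y\<^sup>2 \<le> J / 2" using y0 J by (simp add: field_simps)
    moreover have "J \<le> N + C2 / y\<^sup>2"
      using C(4)[OF y0(1)] norm_triangle_sub[of "mellin s" "of_real (y\<^sup>2) * stieltjes s y"]
      by (simp only: J_def N_def norm_minus_commute)
    ultimately have "J / 2 \<le> N" by linarith
    then have "norm ((2::complex) powr s) * \<bar>sin y\<bar> * (J / 2) \<le> norm (D y)"
      unfolding D by (intro mult_left_mono) auto
    then show ?thesis by (simp add: c_def mult_ac)
  qed
  have "ennreal (c powr p) * (\<integral>\<^sup>+ y. ennreal (\<bar>sin y\<bar> powr p) * indicator {Y..} y \<partial>lborel) =
      (\<integral>\<^sup>+ y. ennreal (c powr p) * (ennreal (\<bar>sin y\<bar> powr p) * indicator {Y..} y) \<partial>lborel)"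
    by (rule nn_integral_cmult [symmetric]) measurable
  also have "\<dots> = (\<integral>\<^sup>+ y. ennreal (c powr p) * (ennreal (\<bar>sin y\<bar> powr p) * indicator {Y..} y) \<partial>lebesgue)"
    by (rule nn_integral_completion [symmetric])
  also have "\<dots> \<le> (\<integral>\<^sup>+ y. ennreal (norm (D y) powr p) \<partial>lebesgue)"
  proof (rule nn_integral_mono_AE)
    show "AE y in lebesgue. ennreal (c powr p) * (ennreal (\<bar>sin y\<bar> powr p) * indicator {Y..} y) \<le> ennreal (norm (D y) powr p)"
      using AE_sin_nonzero
    proof eventually_elim
      case (elim y)
      show ?case
      proof (cases "y \<ge> Y")
        case True
        have "c powr p * \<bar>sin y\<bar> powr p = (c * \<bar>sin y\<bar>) powr p" using c by (simp add: powr_mult)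
        also have "\<dots> \<le> norm (D y) powr p" using lower[OF True elim] c p by (intro powr_mono2) auto
        finally show ?thesis using True by (simp add: ennreal_mult [symmetric] ennreal_leI)
      qed simp
    qed
  qed
  also have "\<dots> < \<infinity>" using mem by (simp add: L_space_def D_def)
  finally show False
    unfolding nn_integral_sin_powr_infinite[OF p] using c by (simp add: ennreal_mult_top)
qed

end

theorem corollary2p10:
  fixes q :: nat and chi :: "int \<Rightarrow> complex" and s :: complex
  assumes "q > 1"
    and "dirichlet_character q chi"
    and "chi \<noteq> principal_character q"
    and "0 < Re s" and "Re s < 1"
  shows "(Dirichlet_L chi s = 0 \<longrightarrow>
            (\<forall>p>1/2. (\<lambda>y. varphi q chi s y - gamma_fun q chi s y) \<in> L_space p)) \<and>
         ((\<exists>p>1/2. (\<lambda>y. varphi q chi s y - gamma_fun q chi s y) \<in> L_space p) \<longrightarrow>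
            Dirichlet_L chi s = 0)"
proof -
  interpret nonprincipal_character q chi
    using assms by unfold_locales
  \<comment> \<open>Gamma has no zeros, so \<open>mellin s\<close> and the L-value vanish
    together.\<close>
  have "Gamma s \<noteq> 0" using assms by (auto simp: Gamma_eq_zero_iff elim!: nonpos_Ints_cases)
  then have "mellin s = 0 \<longleftrightarrow> Dirichlet_L chi s = 0"
    using mellin_eq[of s] assms by simp
  then show ?thesis
    using difference_in_L_space[of s] difference_not_in_L_space[of s] assms
    by (metis less_trans half_gt_zero_iff zero_less_one)
qed

end
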